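(* Let $(A,\Delta)$ be an algebraic quantum group and let $(X,\alpha)$ be a right $A$-Galois object. Then there exists a non-zero invariant functional $\psi_X$ on $X$, i.e. a non-zero functional with $(\psi_X\otimes\iota)\alpha(x)=\psi_X(x)1$ for all $x\in X$.
   Context: Conventions: $k$ is a field; all algebras are $k$-algebras, non-zero, possibly without unit, and non-degenerate ($ab=0$ for all $b$ implies $a=0$, and $ab=0$ for all $a$ implies $b=0$). $M(X)$ is the multiplier algebra of $X$, with $X\subseteq M(X)$ and $k=k\cdot 1\subseteq M(X)$; $\otimes$ is over $k$; $\iota$ is the identity map; functionals are linear. A regular multiplier Hopf algebra is a pair $(A,\Delta)$ with $A$ an algebra and $\Delta:A\to M(A\otimes A)$ a coassociative homomorphism which is non-degenerate ($\Delta(A)(A\otimes A)=A\otimes A=(A\otimes A)\Delta(A)$) and such that the maps sending $a\otimes b$ to $\Delta(a)(1\otimes b)$, $(a\otimes 1)\Delta(b)$, $\Delta(a)(b\otimes 1)$, $(1\otimes a)\Delta(b)$ are all bijections of $A\otimes A$ onto $A\otimes A$. An algebraic quantum group is a regular multiplier Hopf algebra with a non-zero functional $\varphi$ such that $(\iota\otimes\varphi)(\Delta(a)(b\otimes 1))=\varphi(a)b$ for all $a,b\in A$. A right coaction of $A$ on an algebra $X$ is an injective homomorphism $\alpha:X\to M(X\otimes A)$ with $\alpha(X)(1\otimes A)\subseteq X\otimes A$, $(1\otimes A)\alpha(X)\subseteq X\otimes A$ and $(\alpha\otimes\iota)\alpha=(\iota\otimes\Delta)\alpha$; it extends canonically to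 $M(X)\to M(X\otimes A)$. It is reduced if also $(X\otimes 1)\alpha(X)\subseteq X\otimes A$ (then also $\alpha(X)(X\otimes 1)\subseteq X\otimes A$). The coinvariants are the $f\in M(X)$ with $\alpha(f)=f\otimes 1$. $(X,\alpha)$ is a right $A$-Galois object if $\alpha$ is a reduced right coaction, the algebra of coinvariants is $k$, and $V:X\otimes X\to X\otimes A$, $x\otimes y\mapsto (x\otimes 1)\alpha(y)$, is bijective. For a functional $\omega$ on $X$, $(\omega\otimes\iota)\alpha(x)$ is interpreted as a multiplier of $A$. *)

theory Defs
  imports Complex_Main "HOL-Library.Poly_Mapping"
begin

section \<open>Algebras\<close>

text \<open>
  Addition and the (associative, bilinear, not necessarily unital) multiplication come from the
  type class \<^class>\<open>ring\<close>, which does not require a unit; the action of the field is a parameter.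
\<close>

locale k_algebra = vector_space scale
  for scale :: "'k::field \<Rightarrow> 'a::ring \<Rightarrow> 'a" +
  assumes nonzero: "\<exists>a::'a. a \<noteq> 0"
    and scale_mult_left: "scale c (a * b) = scale c a * b"
    and scale_mult_right: "scale c (a * b) = a * scale c b"
    and nondegenerate_left: "(\<And>b. a * b = 0) \<Longrightarrow> a = 0"
    and nondegenerate_right: "(\<And>a. a * b = 0) \<Longrightarrow> b = 0"

definition algebra_hom ::
    "('k::field \<Rightarrow> 'a::ring \<Rightarrow> 'a) \<Rightarrow> ('k \<Rightarrow> 'b::ring \<Rightarrow> 'b) \<Rightarrow> ('a \<Rightarrow> 'b) \<Rightarrow> bool" where
  "algebra_hom sA sB f \<longleftrightarrow> Vector_Spaces.linear sA sB f \<and> (\<forall>a b. f (a * b) = f a * f b)"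


section \<open>Multiplier algebras\<close>

text \<open>
  A multiplier is a pair \<open>(L, R)\<close>, where \<open>L\<close> is \<open>x \<mapsto> m x\<close> and \<open>R\<close> is \<open>x \<mapsto> x m\<close>.
  Only additivity is required: over a non-degenerate algebra both maps are automatically linear over
  the field, see \<open>app_l_scale\<close> and \<open>app_r_scale\<close> below.
\<close>

typedef (overloaded) 'a multiplier =
  "{(L :: 'a::ring \<Rightarrow> 'a, R :: 'a \<Rightarrow> 'a).
      (\<forall>x y. L (x + y) = L x + L y) \<and> (\<forall>x y. R (x + y) = R x + R y) \<and>
      (\<forall>x y. L (x * y) = L x * y) \<and> (\<forall>x y. R (x * y) = x * R y) \<and>
      (\<forall>x y. x * L y = R x * y)}"
  by (rule exI[of _ "(\<lambda>x. x, \<lambda>x. x)"]) simp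

setup_lifting type_definition_multiplier

lift_definition app_l :: "'a::ring multiplier \<Rightarrow> 'a \<Rightarrow> 'a" is fst .
lift_definition app_r :: "'a::ring multiplier \<Rightarrow> 'a \<Rightarrow> 'a" is snd .

lemma multiplier_eqI: "app_l m = app_l n \<Longrightarrow> app_r m = app_r n \<Longrightarrow> m = n"
  by transfer (auto simp: prod_eq_iff)

lemma app_props:
  shows app_l_add: "app_l m (x + y) = app_l m x + app_l m y"
    and app_r_add: "app_r m (x + y) = app_r m x + app_r m y"
    and app_l_mult: "app_l m (x * y) = app_l m x * y"
    and app_r_mult: "app_r m (x * y) = x * app_r m y"
    and app_assoc: "x * app_l m y = app_r m x * y"
  by (transfer, auto)+

instantiation multiplier :: (ring) "{ring, monoid_mult}"
begin

lift_definition zero_multiplier :: "'a multiplier" is "(\<lambda>_. 0, \<lambda>_. 0)" by simp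
lift_definition one_multiplier :: "'a multiplier" is "(\<lambda>x. x, \<lambda>x. x)" by simp
lift_definition plus_multiplier :: "'a multiplier \<Rightarrow> 'a multiplier \<Rightarrow> 'a multiplier"
  is "\<lambda>(L, R) (L', R'). (\<lambda>x. L x + L' x, \<lambda>x. R x + R' x)"
  by (auto simp: algebra_simps)
lift_definition minus_multiplier :: "'a multiplier \<Rightarrow> 'a multiplier \<Rightarrow> 'a multiplier"
  is "\<lambda>(L, R) (L', R'). (\<lambda>x. L x - L' x, \<lambda>x. R x - R' x)"
  by (auto simp: algebra_simps)
lift_definition uminus_multiplier :: "'a multiplier \<Rightarrow> 'a multiplier"
  is "\<lambda>(L, R). (\<lambda>x. - L x, \<lambda>x. - R x)"
  by (auto simp: algebra_simps)
lift_definition times_multiplier :: "'a multiplier \<Rightarrow> 'a multiplier \<Rightarrow> 'a multiplier"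
  is "\<lambda>(L, R) (L', R'). (\<lambda>x. L (L' x), \<lambda>x. R' (R x))"
  by (auto; metis)

instance
  by standard (transfer; auto simp: fun_eq_iff algebra_simps)+

end

lift_definition emb :: "'a::ring \<Rightarrow> 'a multiplier" is "\<lambda>a. (\<lambda>x. a * x, \<lambda>x. x * a)"
  by (auto simp: algebra_simps)

definition scalar :: "('k::field \<Rightarrow> 'a::ring \<Rightarrow> 'a) \<Rightarrow> 'k \<Rightarrow> 'a multiplier" where
  "scalar sA c = Abs_multiplier (sA c, sA c)"

definition mscale :: "('k::field \<Rightarrow> 'a::ring \<Rightarrow> 'a) \<Rightarrow> 'k \<Rightarrow> 'a multiplier \<Rightarrow> 'a multiplier" where
  "mscale sA c m = scalar sA c * m"

lemma app_ops [simp]: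
  "app_l 0 x = 0" "app_r 0 x = 0" "app_l 1 x = x" "app_r 1 x = x"
  "app_l (m + n) x = app_l m x + app_l n x" "app_r (m + n) x = app_r m x + app_r n x"
  "app_l (m * n) x = app_l m (app_l n x)" "app_r (m * n) x = app_r n (app_r m x)"
  by (transfer, auto)+

lemma app_emb [simp]: "app_l (emb a) x = a * x" "app_r (emb a) x = x * a"
  by (transfer, simp)+

context k_algebra
begin

lemma app_scalar [simp]: "app_l (scalar scale c) x = scale c x" "app_r (scalar scale c) x = scale c x"
  by (simp_all add: scalar_def app_l.rep_eq app_r.rep_eq Abs_multiplier_inverse scale_right_distrib
      scale_mult_left[symmetric] scale_mult_right[symmetric])

lemma inj_emb: "inj (emb :: 'a \<Rightarrow> 'a multiplier)"
proof (rule injI)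
  fix a b :: 'a assume "emb a = emb b"
  then have "app_l (emb a) x = app_l (emb b) x" for x by simp
  then have "(a - b) * x = 0" for x by (simp add: algebra_simps)
  then show "a = b" using nondegenerate_left[of "a - b"] by simp
qed

lemma app_l_scale: "app_l m (scale c x) = scale c (app_l m x)"
proof -
  have "a * (app_l m (scale c x) - scale c (app_l m x)) = 0" for a
    by (simp add: right_diff_distrib app_assoc scale_mult_right[symmetric])
  then show ?thesis using nondegenerate_right[of "app_l m (scale c x) - scale c (app_l m x)"] by simp
qed

lemma app_r_scale: "app_r m (scale c x) = scale c (app_r m x)"
proof -
  have "(app_r m (scale c x) - scale c (app_r m x)) * b = 0" for b
    by (simp add: left_diff_distrib app_assoc[symmetric] scale_mult_left[symmetric])
  then show ?thesis using nondegenerate_left[of "app_r m (scale c x) - scale c (app_r m x)"] by simp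
qed

lemma vector_space_mscale: "vector_space (mscale scale)"
  by unfold_locales
    (auto intro!: multiplier_eqI simp: fun_eq_iff mscale_def app_l_add app_r_add app_l_scale
      app_r_scale scale_left_distrib scale_right_distrib mult.commute)

end


section \<open>Tensor products\<close>

text \<open>
  A tensor product of \<open>A\<close> and \<open>B\<close> over the field is a vector space \<open>T\<close> with a map \<open>tens\<close> such that
  the linear extension of \<open>tens\<close> to the free vector space on \<open>A \<times> B\<close> is onto \<open>T\<close> and has as kernel
  exactly the span of the bilinearity relations. In other words, \<open>T\<close> is the usual quotient
  of the free vector space, up to the induced isomorphism. As \<open>A\<close>, \<open>B\<close> and \<open>T\<close> are types, such a model
  of the tensor product is a parameter of everything below; it is unique up to
  unique isomorphism by \<open>tensor_product.universal\<close>.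
\<close>

definition free_scale :: "'k::field \<Rightarrow> ('i \<Rightarrow>\<^sub>0 'k) \<Rightarrow> ('i \<Rightarrow>\<^sub>0 'k)" where
  "free_scale c p = Poly_Mapping.map (\<lambda>x. c * x) p"

definition bilinear_relations ::
    "('k::field \<Rightarrow> 'a::ab_group_add \<Rightarrow> 'a) \<Rightarrow> ('k \<Rightarrow> 'b::ab_group_add \<Rightarrow> 'b) \<Rightarrow> ('a \<times> 'b \<Rightarrow>\<^sub>0 'k) set" where
  "bilinear_relations sA sB =
     {Poly_Mapping.single (a + a', b) 1 - Poly_Mapping.single (a, b) 1 - Poly_Mapping.single (a', b) 1 | a a' b. True} \<union>
     {Poly_Mapping.single (a, b + b') 1 - Poly_Mapping.single (a, b) 1 - Poly_Mapping.single (a, b') 1 | a b b'. True} \<union>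
     {Poly_Mapping.single (sA c a, b) 1 - Poly_Mapping.single (a, b) c | c a b. True} \<union>
     {Poly_Mapping.single (a, sB c b) 1 - Poly_Mapping.single (a, b) c | c a b. True}"

definition free_extend ::
    "('k::field \<Rightarrow> 't::ab_group_add \<Rightarrow> 't) \<Rightarrow> ('a \<Rightarrow> 'b \<Rightarrow> 't) \<Rightarrow> ('a \<times> 'b \<Rightarrow>\<^sub>0 'k) \<Rightarrow> 't" where
  "free_extend sT f p = (\<Sum>(a, b)\<in>Poly_Mapping.keys p. sT (Poly_Mapping.lookup p (a, b)) (f a b))"

locale tensor_product =
  vA: vector_space sA + vB: vector_space sB + vT: vector_space sT
  for sA :: "'k::field \<Rightarrow> 'a::ab_group_add \<Rightarrow> 'a"
    and sB :: "'k \<Rightarrow> 'b::ab_group_add \<Rightarrow> 'b"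
    and sT :: "'k \<Rightarrow> 't::ab_group_add \<Rightarrow> 't"
    and tens :: "'a \<Rightarrow> 'b \<Rightarrow> 't" +
  assumes free_extend_surj: "range (free_extend sT tens) = UNIV"
    and free_extend_kernel:
      "{p. free_extend sT tens p = 0} = module.span free_scale (bilinear_relations sA sB)"

definition bilinear_map ::
    "('k::field \<Rightarrow> 'a::ab_group_add \<Rightarrow> 'a) \<Rightarrow> ('k \<Rightarrow> 'b::ab_group_add \<Rightarrow> 'b) \<Rightarrow>
     ('k \<Rightarrow> 'w::ab_group_add \<Rightarrow> 'w) \<Rightarrow> ('a \<Rightarrow> 'b \<Rightarrow> 'w) \<Rightarrow> bool" where
  "bilinear_map sA sB sW f \<longleftrightarrow>
     (\<forall>b. Vector_Spaces.linear sA sW (\<lambda>a. f a b)) \<and> (\<forall>a. Vector_Spaces.linear sB sW (f a))"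

text \<open>The linear map \<open>T \<rightarrow> W\<close> with \<open>a \<otimes> b \<mapsto> f a b\<close>.\<close>

definition tensor_lift ::
    "('k::field \<Rightarrow> 't::ab_group_add \<Rightarrow> 't) \<Rightarrow> ('a \<Rightarrow> 'b \<Rightarrow> 't) \<Rightarrow> ('k \<Rightarrow> 'w::ab_group_add \<Rightarrow> 'w) \<Rightarrow>
     ('a \<Rightarrow> 'b \<Rightarrow> 'w) \<Rightarrow> 't \<Rightarrow> 'w" where
  "tensor_lift sT tens sW f = (THE g. Vector_Spaces.linear sT sW g \<and> (\<forall>a b. g (tens a b) = f a b))"

lemma lookup_free_scale [simp]: "Poly_Mapping.lookup (free_scale c p) x = c * Poly_Mapping.lookup p x"
  unfolding free_scale_def by transfer (auto simp: when_def)

lemma vector_space_free_scale: "vector_space (free_scale :: 'k::field \<Rightarrow> ('i \<Rightarrow>\<^sub>0 'k) \<Rightarrow> _)"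
  by unfold_locales (auto intro!: poly_mapping_eqI simp: lookup_add algebra_simps)

lemma free_extend_superset:
  assumes "vector_space sT" "finite S" "Poly_Mapping.keys p \<subseteq> S"
  shows "free_extend sT f p = (\<Sum>(a, b)\<in>S. sT (Poly_Mapping.lookup p (a, b)) (f a b))"
proof -
  interpret vector_space sT by fact
  show ?thesis
    unfolding free_extend_def using assms(2,3)
    by (intro sum.mono_neutral_left) (auto simp: in_keys_iff)
qed

lemma linear_free_extend:
  fixes sT :: "'k::field \<Rightarrow> 't::ab_group_add \<Rightarrow> 't"
  assumes "vector_space sT"
  shows "Vector_Spaces.linear free_scale sT (free_extend sT f)"
proof -
  interpret T: vector_space sT by fact
  interpret F: vector_space "free_scale :: 'k \<Rightarrow> ('a \<times> 'b \<Rightarrow>\<^sub>0 'k) \<Rightarrow> _" by (rule vector_space_free_scale)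
  show ?thesis
  proof unfold_locales
    fix p q :: "'a \<times> 'b \<Rightarrow>\<^sub>0 'k"
    let ?S = "Poly_Mapping.keys p \<union> Poly_Mapping.keys q"
    show "free_extend sT f (p + q) = free_extend sT f p + free_extend sT f q"
      by (subst (1 2 3) free_extend_superset[OF assms, of ?S])
        (auto simp: lookup_add T.scale_left_distrib sum.distrib[symmetric] in_keys_iff intro!: sum.cong)
  next
    fix c :: 'k and p :: "'a \<times> 'b \<Rightarrow>\<^sub>0 'k"
    show "free_extend sT f (free_scale c p) = sT c (free_extend sT f p)"
      by (subst (1 2) free_extend_superset[OF assms, of "Poly_Mapping.keys p"])
        (auto simp: in_keys_iff T.scale_sum_right intro!: sum.cong)
  qed
qed

lemma free_extend_single:
  assumes "vector_space sT"
  shows "free_extend sT f (Poly_Mapping.single (a, b) c) = sT c (f a b)"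
  by (subst free_extend_superset[OF assms, of "{(a, b)}"]) (auto split: if_splits)

context tensor_product
begin

lemma universal:
  fixes sW :: "'k \<Rightarrow> 'w::ab_group_add \<Rightarrow> 'w"
  assumes W: "vector_space sW" and f: "bilinear_map sA sB sW f"
  shows "\<exists>!g. Vector_Spaces.linear sT sW g \<and> (\<forall>a b. g (tens a b) = f a b)"
proof -
  interpret W: vector_space sW by fact
  interpret F: vector_space "free_scale :: 'k \<Rightarrow> ('a \<times> 'b \<Rightarrow>\<^sub>0 'k) \<Rightarrow> _" by (rule vector_space_free_scale)
  let ?T = "free_extend sT tens" and ?W = "free_extend sW f"
  interpret T': Vector_Spaces.linear free_scale sT ?T by (rule linear_free_extend) unfold_locales
  interpret W': Vector_Spaces.linear free_scale sW ?W by (rule linear_free_extend) unfold_locales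
  have f1: "Vector_Spaces.linear sA sW (\<lambda>a. f a b)" and f2: "Vector_Spaces.linear sB sW (f a)" for a b
    using f by (auto simp: bilinear_map_def)
  note fs = module_hom.add[OF module_hom_linearI[OF f1]] module_hom.add[OF module_hom_linearI[OF f2]]
    module_hom.scale[OF module_hom_linearI[OF f1]] module_hom.scale[OF module_hom_linearI[OF f2]]
  have rel: "?W p = 0" if "p \<in> bilinear_relations sA sB" for p
    using that unfolding bilinear_relations_def
    by (auto simp: W'.diff free_extend_single[OF W] fs)
  have ker: "?W p = 0" if "?T p = 0" for p
  proof -
    have "p \<in> F.span (bilinear_relations sA sB)" using that free_extend_kernel by auto
    then show ?thesis
      by (induction rule: F.span_induct_alt) (auto simp: W'.add W'.scale rel W'.zero)
  qed
  have eq: "?W p = ?W q" if "?T p = ?T q" for p q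
    using ker[of "p - q"] that by (simp add: T'.diff W'.diff)
  define g where "g t = ?W (SOME p. ?T p = t)" for t
  have gT: "g (?T p) = ?W p" for p
    unfolding g_def by (rule eq) (rule someI[of _ p], simp)
  have surj: "\<exists>p. t = ?T p" for t using free_extend_surj by (metis UNIV_I imageE)
  have lin: "Vector_Spaces.linear sT sW g"
  proof unfold_locales
    show "g (x + y) = g x + g y" for x y
      using surj[of x] surj[of y] by (metis T'.add W'.add gT)
    show "g (sT c x) = sW c (g x)" for c x
      using surj[of x] by (metis T'.scale W'.scale gT)
  qed
  have gt: "g (tens a b) = f a b" for a b
    using gT[of "Poly_Mapping.single (a, b) 1"]
    by (simp add: free_extend_single[OF W] free_extend_single[OF vT.vector_space_axioms])
  show ?thesis
  proof (rule ex1I[of _ g])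
    show "Vector_Spaces.linear sT sW g \<and> (\<forall>a b. g (tens a b) = f a b)" using lin gt by blast
  next
    fix h assume h: "Vector_Spaces.linear sT sW h \<and> (\<forall>a b. h (tens a b) = f a b)"
    interpret h: Vector_Spaces.linear sT sW h using h by blast
    have "h (?T p) = ?W p" for p
      unfolding free_extend_def by (auto simp: h.sum h.scale h intro!: sum.cong)
    then show "h = g" using surj gT by (metis ext)
  qed
qed

end

text \<open>Compatibility of the multiplication of \<open>T\<close> with the action of the field is a consequence.\<close>

locale algebra_tensor = tensor_product sA sB sT tens
  for sA :: "'k::field \<Rightarrow> 'a::ring \<Rightarrow> 'a"
    and sB :: "'k \<Rightarrow> 'b::ring \<Rightarrow> 'b"
    and sT :: "'k \<Rightarrow> 't::ring \<Rightarrow> 't"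
    and tens :: "'a \<Rightarrow> 'b \<Rightarrow> 't" +
  assumes tens_mult: "tens a b * tens a' b' = tens (a * a') (b * b')"

text \<open>
  \<open>U\<close> is both \<open>(X \<otimes> A) \<otimes> B\<close>, via \<open>tL\<close>, and \<open>X \<otimes> (A \<otimes> B)\<close>, via \<open>tR\<close>.
\<close>

locale triple_tensor =
  XA: algebra_tensor sX sA sXA tXA + AB: algebra_tensor sA sB sAB tAB +
  L: algebra_tensor sXA sB sU tL + R: algebra_tensor sX sAB sU tR
  for sX :: "'k::field \<Rightarrow> 'x::ring \<Rightarrow> 'x"
    and sA :: "'k \<Rightarrow> 'a::ring \<Rightarrow> 'a"
    and sB :: "'k \<Rightarrow> 'b::ring \<Rightarrow> 'b"
    and sXA :: "'k \<Rightarrow> 'xa::ring \<Rightarrow> 'xa" and tXA :: "'x \<Rightarrow> 'a \<Rightarrow> 'xa"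
    and sAB :: "'k \<Rightarrow> 'ab::ring \<Rightarrow> 'ab" and tAB :: "'a \<Rightarrow> 'b \<Rightarrow> 'ab"
    and sU :: "'k \<Rightarrow> 'u::ring \<Rightarrow> 'u" and tL :: "'xa \<Rightarrow> 'b \<Rightarrow> 'u" and tR :: "'x \<Rightarrow> 'ab \<Rightarrow> 'u" +
  assumes assoc: "tL (tXA x a) b = tR x (tAB a b)"

text \<open>\<open>m \<otimes> n \<in> M(X \<otimes> A)\<close> for \<open>m \<in> M(X)\<close> and \<open>n \<in> M(A)\<close>.\<close>

definition mtens :: "('x::ring \<Rightarrow> 'a::ring \<Rightarrow> 't::ring) \<Rightarrow> 'x multiplier \<Rightarrow> 'a multiplier \<Rightarrow> 't multiplier" where
  "mtens tens m n = (THE p. \<forall>x a. app_l p (tens x a) = tens (app_l m x) (app_l n a) \<and>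
                                 app_r p (tens x a) = tens (app_r m x) (app_r n a))"


section \<open>Extensions and coassociativity\<close>

text \<open>
  The value at \<open>m \<in> M(B)\<close> of the canonical extension to \<open>M(B)\<close> of a homomorphism \<open>f : B \<rightarrow> M(C)\<close>.
\<close>

definition mult_ext :: "('b::ring \<Rightarrow> 'c::ring multiplier) \<Rightarrow> 'b multiplier \<Rightarrow> 'c multiplier" where
  "mult_ext f m = (THE n. \<forall>b. n * f b = f (app_l m b) \<and> f b * n = f (app_r m b))"

text \<open>\<open>\<iota> \<otimes> \<Delta>\<close> as a map from \<open>X \<otimes> A\<close> to \<open>M(X \<otimes> (A \<otimes> A))\<close>; it is extended to \<open>M(X \<otimes> A)\<close> by \<open>mult_ext\<close>.\<close>

definition id_tens_hom ::
    "('k::field \<Rightarrow> 'xa::ring \<Rightarrow> 'xa) \<Rightarrow> ('x::ring \<Rightarrow> 'a::ring \<Rightarrow> 'xa) \<Rightarrow>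
     ('k \<Rightarrow> 'u::ring \<Rightarrow> 'u) \<Rightarrow> ('x \<Rightarrow> 'aa::ring \<Rightarrow> 'u) \<Rightarrow>
     ('a \<Rightarrow> 'aa multiplier) \<Rightarrow> 'xa \<Rightarrow> 'u multiplier" where
  "id_tens_hom sXA tXA sU tR \<Delta> = tensor_lift sXA tXA (mscale sU) (\<lambda>x a. mtens tR (emb x) (\<Delta> a))"

text \<open>\<open>\<alpha> \<otimes> \<iota>\<close> as a map from \<open>X \<otimes> A\<close> to \<open>M((X \<otimes> A) \<otimes> A)\<close>.\<close>

definition hom_tens_id ::
    "('k::field \<Rightarrow> 'xa::ring \<Rightarrow> 'xa) \<Rightarrow> ('x::ring \<Rightarrow> 'a::ring \<Rightarrow> 'xa) \<Rightarrow>
     ('k \<Rightarrow> 'u::ring \<Rightarrow> 'u) \<Rightarrow> ('xa \<Rightarrow> 'a \<Rightarrow> 'u) \<Rightarrow>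
     ('x \<Rightarrow> 'xa multiplier) \<Rightarrow> 'xa \<Rightarrow> 'u multiplier" where
  "hom_tens_id sXA tXA sU tL \<alpha> = tensor_lift sXA tXA (mscale sU) (\<lambda>x a. mtens tL (\<alpha> x) (emb a))"

text \<open>
  \<open>(\<alpha> \<otimes> \<iota>)(m)\<close> for a multiplier \<open>m\<close> of \<open>X \<otimes> A\<close> with \<open>m (1 \<otimes> a)\<close> and \<open>(1 \<otimes> a) m\<close> in \<open>X \<otimes> A\<close> for
  all \<open>a\<close>: the multiplier \<open>n\<close> with \<open>n (1 \<otimes> 1 \<otimes> a) = (\<alpha> \<otimes> \<iota>)(m (1 \<otimes> a))\<close> and
  \<open>(1 \<otimes> 1 \<otimes> a) n = (\<alpha> \<otimes> \<iota>)((1 \<otimes> a) m)\<close>. This makes sense before \<open>\<alpha>\<close> is known to be extendable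
  to \<open>M(X)\<close>.
\<close>

definition hom_tens_id_ext ::
    "('k::field \<Rightarrow> 'xa::ring \<Rightarrow> 'xa) \<Rightarrow> ('x::ring \<Rightarrow> 'a::ring \<Rightarrow> 'xa) \<Rightarrow>
     ('k \<Rightarrow> 'u::ring \<Rightarrow> 'u) \<Rightarrow> ('xa \<Rightarrow> 'a \<Rightarrow> 'u) \<Rightarrow>
     ('x \<Rightarrow> 'xa multiplier) \<Rightarrow> 'xa multiplier \<Rightarrow> 'u multiplier" where
  "hom_tens_id_ext sXA tXA sU tL \<alpha> m = (THE n. \<forall>a.
     n * mtens tL 1 (emb a) = hom_tens_id sXA tXA sU tL \<alpha> (inv emb (m * mtens tXA 1 (emb a))) \<and>
     mtens tL 1 (emb a) * n = hom_tens_id sXA tXA sU tL \<alpha> (inv emb (mtens tXA 1 (emb a) * m)))"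

definition coassociative ::
    "('k::field \<Rightarrow> 'xa::ring \<Rightarrow> 'xa) \<Rightarrow> ('x::ring \<Rightarrow> 'a::ring \<Rightarrow> 'xa) \<Rightarrow>
     ('k \<Rightarrow> 'u::ring \<Rightarrow> 'u) \<Rightarrow> ('xa \<Rightarrow> 'a \<Rightarrow> 'u) \<Rightarrow> ('x \<Rightarrow> 'aa::ring \<Rightarrow> 'u) \<Rightarrow>
     ('x \<Rightarrow> 'xa multiplier) \<Rightarrow> ('a \<Rightarrow> 'aa multiplier) \<Rightarrow> bool" where
  "coassociative sXA tXA sU tL tR \<alpha> \<Delta> \<longleftrightarrow>
     (\<forall>x. hom_tens_id_ext sXA tXA sU tL \<alpha> (\<alpha> x) = mult_ext (id_tens_hom sXA tXA sU tR \<Delta>) (\<alpha> x))"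


section \<open>Functionals and slice maps\<close>

definition slice_right ::
    "('k::field \<Rightarrow> 'x::ring \<Rightarrow> 'x) \<Rightarrow> ('k \<Rightarrow> 't::ring \<Rightarrow> 't) \<Rightarrow> ('x \<Rightarrow> 'a::ring \<Rightarrow> 't) \<Rightarrow> ('a \<Rightarrow> 'k) \<Rightarrow> 't \<Rightarrow> 'x" where
  "slice_right sX sT tens \<phi> = tensor_lift sT tens sX (\<lambda>x a. sX (\<phi> a) x)"

definition slice_left ::
    "('k::field \<Rightarrow> 'a::ring \<Rightarrow> 'a) \<Rightarrow> ('k \<Rightarrow> 't::ring \<Rightarrow> 't) \<Rightarrow> ('x::ring \<Rightarrow> 'a \<Rightarrow> 't) \<Rightarrow> ('x \<Rightarrow> 'k) \<Rightarrow> 't \<Rightarrow> 'a" where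
  "slice_left sA sT tens \<omega> = tensor_lift sT tens sA (\<lambda>x a. sA (\<omega> x) a)"

text \<open>
  \<open>(\<omega> \<otimes> \<iota>)(m) \<in> M(A)\<close> for a multiplier \<open>m\<close> of \<open>X \<otimes> A\<close> with \<open>m (1 \<otimes> a)\<close> and \<open>(1 \<otimes> a) m\<close> in
  \<open>X \<otimes> A\<close> for all \<open>a\<close>: its products with \<open>a\<close> are obtained by applying \<open>\<omega> \<otimes> \<iota>\<close> to these elements.
\<close>

definition mult_slice_left ::
    "('k::field \<Rightarrow> 'a::ring \<Rightarrow> 'a) \<Rightarrow> ('k \<Rightarrow> 't::ring \<Rightarrow> 't) \<Rightarrow> ('x::ring \<Rightarrow> 'a \<Rightarrow> 't) \<Rightarrow> ('x \<Rightarrow> 'k) \<Rightarrow>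
     't multiplier \<Rightarrow> 'a multiplier" where
  "mult_slice_left sA sT tens \<omega> m = (THE n. \<forall>a.
     app_l n a = slice_left sA sT tens \<omega> (inv emb (m * mtens tens 1 (emb a))) \<and>
     app_r n a = slice_left sA sT tens \<omega> (inv emb (mtens tens 1 (emb a) * m)))"


section \<open>Algebraic quantum groups and Galois objects\<close>

definition bijective_onto_tensor ::
    "('k::field \<Rightarrow> 's::ab_group_add \<Rightarrow> 's) \<Rightarrow> ('a \<Rightarrow> 'b \<Rightarrow> 's) \<Rightarrow> ('k \<Rightarrow> 't::ring \<Rightarrow> 't) \<Rightarrow>
     ('a \<Rightarrow> 'b \<Rightarrow> 't multiplier) \<Rightarrow> bool" where
  "bijective_onto_tensor sS tens sT f \<longleftrightarrow>
     bij_betw (tensor_lift sS tens (mscale sT) f) UNIV (range emb)"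

locale regular_multiplier_hopf_algebra =
  k_algebra sA + triple_tensor sA sA sA sAA tAA sAA tAA sAAA tL tR
  for sA :: "'k::field \<Rightarrow> 'a::ring \<Rightarrow> 'a"
    and sAA :: "'k \<Rightarrow> 'aa::ring \<Rightarrow> 'aa" and tAA :: "'a \<Rightarrow> 'a \<Rightarrow> 'aa"
    and sAAA :: "'k \<Rightarrow> 'aaa::ring \<Rightarrow> 'aaa" and tL :: "'aa \<Rightarrow> 'a \<Rightarrow> 'aaa" and tR :: "'a \<Rightarrow> 'aa \<Rightarrow> 'aaa" +
  fixes \<Delta> :: "'a \<Rightarrow> 'aa multiplier"
  assumes hom: "algebra_hom sA (mscale sAA) \<Delta>"
    and coassoc: "coassociative sAA tAA sAAA tL tR \<Delta> \<Delta>"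
    and nondeg_l: "module.span sAA {app_l (\<Delta> a) z | a z. True} = UNIV"
    and nondeg_r: "module.span sAA {app_r (\<Delta> a) z | a z. True} = UNIV"
    and bij1: "bijective_onto_tensor sAA tAA sAA (\<lambda>a b. \<Delta> a * mtens tAA 1 (emb b))"
    and bij2: "bijective_onto_tensor sAA tAA sAA (\<lambda>a b. mtens tAA (emb a) 1 * \<Delta> b)"
    and bij3: "bijective_onto_tensor sAA tAA sAA (\<lambda>a b. \<Delta> a * mtens tAA (emb b) 1)"
    and bij4: "bijective_onto_tensor sAA tAA sAA (\<lambda>a b. mtens tAA 1 (emb a) * \<Delta> b)"

locale algebraic_quantum_group = regular_multiplier_hopf_algebra +
  assumes left_invariant_functional:
    "\<exists>\<phi>. Vector_Spaces.linear sA (*) \<phi> \<and> (\<exists>a. \<phi> a \<noteq> 0) \<and>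
       (\<forall>a b. slice_right sA sAA tAA \<phi> (inv emb (\<Delta> a * mtens tAA (emb b) 1)) = sA (\<phi> a) b)"

locale right_coaction =
  A: k_algebra sA + X: k_algebra sX + triple_tensor sX sA sA sXA tXA sAA tAA sXAA tL tR
  for sA :: "'k::field \<Rightarrow> 'a::ring \<Rightarrow> 'a"
    and sAA :: "'k \<Rightarrow> 'aa::ring \<Rightarrow> 'aa" and tAA :: "'a \<Rightarrow> 'a \<Rightarrow> 'aa"
    and \<Delta> :: "'a \<Rightarrow> 'aa multiplier"
    and sX :: "'k \<Rightarrow> 'x::ring \<Rightarrow> 'x"
    and sXA :: "'k \<Rightarrow> 'xa::ring \<Rightarrow> 'xa" and tXA :: "'x \<Rightarrow> 'a \<Rightarrow> 'xa"
    and sXAA :: "'k \<Rightarrow> 'xaa::ring \<Rightarrow> 'xaa" and tL :: "'xa \<Rightarrow> 'a \<Rightarrow> 'xaa" and tR :: "'x \<Rightarrow> 'aa \<Rightarrow> 'xaa" +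
  fixes \<alpha> :: "'x \<Rightarrow> 'xa multiplier"
  assumes inj: "inj \<alpha>"
    and hom: "algebra_hom sX (mscale sXA) \<alpha>"
    and covers_r: "\<alpha> x * mtens tXA 1 (emb a) \<in> range emb"
    and covers_l: "mtens tXA 1 (emb a) * \<alpha> x \<in> range emb"
    and coassoc: "coassociative sXA tXA sXAA tL tR \<alpha> \<Delta>"

definition coinvariants ::
    "('x::ring \<Rightarrow> 'a::ring \<Rightarrow> 'xa::ring) \<Rightarrow> ('x \<Rightarrow> 'xa multiplier) \<Rightarrow> 'x multiplier set" where
  "coinvariants tXA \<alpha> = {f. mult_ext \<alpha> f = mtens tXA f 1}"

locale galois_object =
  right_coaction sA sAA tAA \<Delta> sX sXA tXA sXAA tL tR \<alpha> + XX: tensor_product sX sX sXX tXX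
  for sA :: "'k::field \<Rightarrow> 'a::ring \<Rightarrow> 'a"
    and sAA :: "'k \<Rightarrow> 'aa::ring \<Rightarrow> 'aa" and tAA :: "'a \<Rightarrow> 'a \<Rightarrow> 'aa"
    and \<Delta> :: "'a \<Rightarrow> 'aa multiplier"
    and sX :: "'k \<Rightarrow> 'x::ring \<Rightarrow> 'x"
    and sXA :: "'k \<Rightarrow> 'xa::ring \<Rightarrow> 'xa" and tXA :: "'x \<Rightarrow> 'a \<Rightarrow> 'xa"
    and sXAA :: "'k \<Rightarrow> 'xaa::ring \<Rightarrow> 'xaa" and tL :: "'xa \<Rightarrow> 'a \<Rightarrow> 'xaa" and tR :: "'x \<Rightarrow> 'aa \<Rightarrow> 'xaa"
    and \<alpha> :: "'x \<Rightarrow> 'xa multiplier"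
    and sXX :: "'k \<Rightarrow> 'xx::ab_group_add \<Rightarrow> 'xx" and tXX :: "'x \<Rightarrow> 'x \<Rightarrow> 'xx" +
  assumes reduced: "mtens tXA (emb x) 1 * \<alpha> y \<in> range emb"
    and coinvariants_eq: "coinvariants tXA \<alpha> = range (scalar sX)"
    and galois_bij: "bijective_onto_tensor sXX tXX sXA (\<lambda>x y. mtens tXA (emb x) 1 * \<alpha> y)"

end

theory Submission
  imports Defs
begin

text \<open>
  A functional on \<open>X\<close> is invariant iff it is a morphism of right comodules \<open>X \<rightarrow> k\<close>. By
  coassociativity the Galois map \<open>V (x \<otimes> y) = (x \<otimes> 1) \<alpha>(y)\<close> intertwines the coactions \<open>\<iota> \<otimes> \<alpha>\<close>
  of \<open>X \<otimes> X\<close> and \<open>\<iota> \<otimes> \<Delta>\<close> of \<open>X \<otimes> A\<close>. So if \<open>\<psi>\<close> is a functional on \<open>A\<close> with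
  \<open>(\<psi> \<otimes> \<iota>)\<Delta>(a) = \<psi>(a) 1\<close>, then for every functional \<open>\<omega>\<close> on \<open>X\<close> and every \<open>y\<close> in \<open>X\<close> the functional
  \<open>x \<mapsto> (\<omega> \<otimes> \<psi>)((y \<otimes> 1) \<alpha>(x))\<close> is invariant (\<open>invariant_on_X\<close>). As \<open>V\<close> is onto, these functionals
  do not all vanish when \<open>\<omega>\<close> and \<open>\<psi>\<close> are non-zero.

  What is given on \<open>A\<close> is a left invariant \<open>\<phi>\<close>, and \<open>\<psi>\<close> is \<open>\<phi> \<circ> S\<close> for the antipode \<open>S\<close>. In Sweedler
  notation, \<open>S\<close> is characterised by \<open>S(a\<^sub>1 \<phi>(a\<^sub>2 b)) = b\<^sub>1 \<phi>(a b\<^sub>2)\<close>: the elements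
  \<open>a\<^sub>1 \<phi>(a\<^sub>2 b)\<close> span \<open>A\<close>, and the formula is consistent because \<open>p b\<^sub>1 \<phi>(a b\<^sub>2)\<close> is the image of
  \<open>p \<otimes> a\<^sub>1 \<phi>(a\<^sub>2 b)\<close> under the map \<open>p \<otimes> c \<mapsto> p S(c)\<close>, which has an independent description: it
  is \<open>\<iota> \<otimes> \<epsilon>\<close> after the inverse of \<open>p \<otimes> c \<mapsto> (p \<otimes> 1) \<Delta>(c)\<close> (\<open>antipode\<close>). The counit \<open>\<epsilon>\<close> comes from the
  inverse of \<open>a \<otimes> b \<mapsto> \<Delta>(a) (1 \<otimes> b)\<close> followed by multiplication (\<open>counit\<close>). Right invariance of
  \<open>\<psi>\<close> is checked on the spanning elements in \<open>right_invariant_functional\<close>.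

  Every use of coassociativity goes through one identity between elements of threefold tensor
  products, \<open>(V \<otimes> \<iota>)(\<iota> \<otimes> T) = (\<iota> \<otimes> T)(V \<otimes> \<iota>)\<close> with \<open>T\<close> given by \<open>\<alpha>(x) (1 \<otimes> a)\<close> on the left hand
  side and by \<open>\<Delta>(b) (1 \<otimes> a)\<close> on the right hand side (\<open>V_id_cover_r2\<close>). It is derived simultaneously
  for \<open>\<alpha>\<close> and for \<open>\<Delta>\<close>, a coaction of \<open>A\<close> on itself. Coassociativity itself equates two
  multipliers given by definite descriptions; that they exist is \<open>multiplier_from_products\<close>.
\<close>

section \<open>Linear functionals and tensor products\<close>

lemma vector_space_field: "vector_space ((*) :: 'k::field \<Rightarrow> 'k \<Rightarrow> 'k)"
  by unfold_locales (auto simp: algebra_simps)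

lemma linearD:
  assumes "Vector_Spaces.linear s t f"
  shows "f (x + y) = f x + f y" "f (s c x) = t c (f x)" "f 0 = 0" "f (x - y) = f x - f y"
proof -
  interpret Vector_Spaces.linear s t f by fact
  show "f (x + y) = f x + f y" "f (s c x) = t c (f x)" "f 0 = 0" "f (x - y) = f x - f y"
    by (rule add scale zero diff)+
qed

lemma linear_compose_apply:
  "Vector_Spaces.linear s t f \<Longrightarrow> Vector_Spaces.linear t u g \<Longrightarrow> Vector_Spaces.linear s u (\<lambda>x. g (f x))"
  by (simp add: Vector_Spaces.linear_iff)

lemma bilinear_mapD_linear:
  assumes "bilinear_map sA sB sW f"
  shows "Vector_Spaces.linear sA sW (\<lambda>a. f a b)" "Vector_Spaces.linear sB sW (\<lambda>b. f a b)"
  using assms by (simp_all add: bilinear_map_def)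

lemma linear_inv:
  assumes "Vector_Spaces.linear s t f" "bij f"
  shows "Vector_Spaces.linear t s (inv f)"
proof -
  have i: "inv f (f u) = u" for u using assms(2) by (simp add: bij_is_inj)
  have "inv f (x + y) = inv f x + inv f y" "inv f (t c x) = s c (inv f x)" for c x y
  proof -
    obtain u v where uv: "x = f u" "y = f v" using bij_is_surj[OF assms(2)] by (metis surjD)
    show "inv f (x + y) = inv f x + inv f y" "inv f (t c x) = s c (inv f x)"
      unfolding uv linearD(1,2)[OF assms(1), symmetric] i by (rule refl)+
  qed
  then show ?thesis using assms(1) by (simp add: Vector_Spaces.linear_iff)
qed

context vector_space
begin

lemma separating_functional:
  assumes "x \<notin> span S"
  obtains f where "Vector_Spaces.linear scale (*) f" "f x = 1" "\<And>y. y \<in> S \<Longrightarrow> f y = 0"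
proof -
  interpret k: vector_space "(*) :: 'a \<Rightarrow> 'a \<Rightarrow> 'a" by (rule vector_space_field)
  interpret P: vector_space_pair scale "(*) :: 'a \<Rightarrow> 'a \<Rightarrow> 'a" by unfold_locales
  obtain B where B: "B \<subseteq> S" "independent B" "S \<subseteq> span B"
    using maximal_independent_subset[of S] by blast
  have "span B \<subseteq> span S" using B(1) by (rule span_mono)
  then have x: "x \<notin> span B" using assms by blast
  have ind: "independent (insert x B)" using B(2) x by (simp add: independent_insert)
  obtain f where f: "Vector_Spaces.linear scale (*) f"
      "\<forall>y\<in>insert x B. f y = (if y = x then 1 else 0)"
    using P.linear_independent_extend[OF ind, of "\<lambda>y. if y = x then 1 else 0"] by blast
  have "f y = 0" if "y \<in> span B" for y
    using that
  proof (induction rule: span_induct_alt)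
    case base then show ?case by (rule linearD(3)[OF f(1)])
  next
    case (step c b y)
    have "b \<noteq> x" using x step(1) span_base by blast
    then show ?case using f(2) step by (simp add: linearD(1,2)[OF f(1)])
  qed
  then show ?thesis using that[of f] f B(3) by auto
qed

lemma eq_zero_if_functionals_vanish:
  assumes "\<And>f. Vector_Spaces.linear scale (*) f \<Longrightarrow> f x = 0"
  shows "x = 0"
  using separating_functional[of x "{}"] assms by (metis span_empty singletonD zero_neq_one)

lemma span_eq_UNIV_if_functionals_vanish:
  assumes "\<And>f x. Vector_Spaces.linear scale (*) f \<Longrightarrow> (\<And>y. y \<in> S \<Longrightarrow> f y = 0) \<Longrightarrow> f x = 0"
  shows "span S = UNIV"
  using separating_functional[of _ S] assms by (metis UNIV_eq_I zero_neq_one)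

lemma functional_vanishes_if_span_eq_UNIV:
  assumes "span S = UNIV" "Vector_Spaces.linear scale (*) f" "\<And>y. y \<in> S \<Longrightarrow> f y = 0"
  shows "f x = 0"
proof -
  have "x \<in> span S" using assms(1) by simp
  then show ?thesis
    by (induction rule: span_induct_alt) (simp_all add: linearD[OF assms(2)] assms(3))
qed

end

lemma bilinear_mapD:
  assumes "bilinear_map sA sB sW f"
  shows "f (a + a') b = f a b + f a' b" "f (sA c a) b = sW c (f a b)"
    and "f a (b + b') = f a b + f a b'" "f a (sB c b) = sW c (f a b)" "vector_space sW"
  using assms by (simp_all add: bilinear_map_def Vector_Spaces.linear_iff)

context tensor_product
begin

lemma free_extend_relation:
  "p \<in> bilinear_relations sA sB \<Longrightarrow> free_extend sT tens p = 0"
  using free_extend_kernel module.span_base[OF vector_space_free_scale[folded module_iff_vector_space]]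
  by blast

lemma tens_bilinear:
  shows tens_add_left: "tens (a + a') b = tens a b + tens a' b"
    and tens_add_right: "tens a (b + b') = tens a b + tens a b'"
    and tens_scale_left: "tens (sA c a) b = sT c (tens a b)"
    and tens_scale_right: "tens a (sB c b) = sT c (tens a b)"
proof -
  interpret fe: Vector_Spaces.linear free_scale sT "free_extend sT tens"
    by (rule linear_free_extend) unfold_locales
  note s = free_extend_single[OF vT.vector_space_axioms, of tens]
  have "free_extend sT tens (Poly_Mapping.single (a + a', b) 1 - Poly_Mapping.single (a, b) 1
      - Poly_Mapping.single (a', b) 1) = 0"
    by (rule free_extend_relation) (unfold bilinear_relations_def, blast)
  then show "tens (a + a') b = tens a b + tens a' b" by (simp add: fe.diff fe.add s algebra_simps)
  have "free_extend sT tens (Poly_Mapping.single (a, b + b') 1 - Poly_Mapping.single (a, b) 1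
      - Poly_Mapping.single (a, b') 1) = 0"
    by (rule free_extend_relation) (unfold bilinear_relations_def, blast)
  then show "tens a (b + b') = tens a b + tens a b'" by (simp add: fe.diff fe.add s algebra_simps)
  have "free_extend sT tens (Poly_Mapping.single (sA c a, b) 1 - Poly_Mapping.single (a, b) c) = 0"
    by (rule free_extend_relation) (unfold bilinear_relations_def, blast)
  then show "tens (sA c a) b = sT c (tens a b)" by (simp add: fe.diff s)
  have "free_extend sT tens (Poly_Mapping.single (a, sB c b) 1 - Poly_Mapping.single (a, b) c) = 0"
    by (rule free_extend_relation) (unfold bilinear_relations_def, blast)
  then show "tens a (sB c b) = sT c (tens a b)" by (simp add: fe.diff s)
qed

lemma tens_zero [simp]: "tens 0 b = 0" "tens a 0 = 0"
  using tens_add_left[of 0 0 b] tens_add_right[of a 0 0] by simp_all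

lemma tensor_induct [case_names tens add]:
  assumes tens: "\<And>a b. P (tens a b)" and add: "\<And>s t. P s \<Longrightarrow> P t \<Longrightarrow> P (s + t)"
  shows "P t"
proof -
  obtain p where p: "t = free_extend sT tens p" using free_extend_surj by blast
  have "P (\<Sum>(a, b)\<in>K. sT (Poly_Mapping.lookup p (a, b)) (tens a b))" if "finite K" for K
    using that
  proof (induction K)
    case empty then show ?case using tens[of 0 0] by simp
  next
    case (insert x K)
    then show ?case
      by (cases x) (auto simp: tens_scale_left[symmetric] intro!: add tens)
  qed
  then show ?thesis unfolding p free_extend_def by simp
qed

lemma
  assumes "bilinear_map sA sB sW f"
  shows linear_tensor_lift: "Vector_Spaces.linear sT sW (tensor_lift sT tens sW f)"
    and tensor_lift_tens: "tensor_lift sT tens sW f (tens a b) = f a b"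
proof -
  have W: "vector_space sW"
    using assms unfolding bilinear_map_def Vector_Spaces.linear_iff by blast
  show "Vector_Spaces.linear sT sW (tensor_lift sT tens sW f)"
    "tensor_lift sT tens sW f (tens a b) = f a b"
    using theI'[OF universal[OF W assms]] unfolding tensor_lift_def by auto
qed

lemma bilinear_mapI:
  assumes "vector_space sW"
    and "\<And>a a' b. f (a + a') b = f a b + f a' b" "\<And>c a b. f (sA c a) b = sW c (f a b)"
    and "\<And>a b b'. f a (b + b') = f a b + f a b'" "\<And>c a b. f a (sB c b) = sW c (f a b)"
  shows "bilinear_map sA sB sW f"
  using assms vA.vector_space_axioms vB.vector_space_axioms
  by (simp add: bilinear_map_def Vector_Spaces.linear_iff)

end

context algebra_tensor
begin

abbreviation "sl \<equiv> slice_left sB sT tens"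
abbreviation "sr \<equiv> slice_right sA sT tens"

context
  fixes f assumes f: "Vector_Spaces.linear sA (*) f"
begin

lemma bilinear_sl: "bilinear_map sA sB sB (\<lambda>a b. sB (f a) b)"
  by (intro bilinear_mapI)
    (auto simp: linearD[OF f] vB.scale_left_distrib vB.scale_right_distrib mult.commute
      intro: vB.vector_space_axioms)

lemma linear_sl: "Vector_Spaces.linear sT sB (sl f)"
  unfolding slice_left_def by (rule linear_tensor_lift[OF bilinear_sl])

lemma sl_tens [simp]: "sl f (tens a b) = sB (f a) b"
  unfolding slice_left_def by (rule tensor_lift_tens[OF bilinear_sl])

lemmas sl_add = linearD(1)[OF linear_sl]
lemmas sl_scale = linearD(2)[OF linear_sl]

end

context
  fixes g assumes g: "Vector_Spaces.linear sB (*) g"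
begin

lemma bilinear_sr: "bilinear_map sA sB sA (\<lambda>a b. sA (g b) a)"
  by (intro bilinear_mapI)
    (auto simp: linearD[OF g] vA.scale_left_distrib vA.scale_right_distrib mult.commute
      intro: vA.vector_space_axioms)

lemma linear_sr: "Vector_Spaces.linear sT sA (sr g)"
  unfolding slice_right_def by (rule linear_tensor_lift[OF bilinear_sr])

lemma sr_tens [simp]: "sr g (tens a b) = sA (g b) a"
  unfolding slice_right_def by (rule tensor_lift_tens[OF bilinear_sr])

lemmas sr_add = linearD(1)[OF linear_sr]

end

lemma functional_slices:
  assumes f: "Vector_Spaces.linear sA (*) f" and g: "Vector_Spaces.linear sB (*) g"
  shows "f (sr g t) = g (sl f t)"
  by (induction t rule: tensor_induct)
    (auto simp: f g linearD[OF f] linearD[OF g] sl_add[OF f] sr_add[OF g])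

text \<open>
  Over a basis \<open>E\<close> of \<open>A\<close> every tensor is \<open>\<Sum> e \<otimes> b\<^sub>e\<close>, and \<open>b\<^sub>e\<close> is its slice by the
  coordinate functional of \<open>e\<close>; so the slices determine the tensor.
\<close>

lemma eq_zero_if_slices_left_vanish:
  assumes "\<And>f. Vector_Spaces.linear sA (*) f \<Longrightarrow> sl f t = 0"
  shows "t = 0"
proof -
  obtain E where E: "vA.independent E" "vA.span E = UNIV"
    using vA.maximal_independent_subset[of UNIV] by (metis top.extremum_uniqueI)
  define r where "r e a = vA.representation E a e" for e a
  have r: "Vector_Spaces.linear sA (*) (r e)" for e
    unfolding r_def by (rule vA.linear_representation[OF E])
  \<comment> \<open>Expansions over all larger finite sets are required, so that those of two tensors can be added.\<close>
  have "\<exists>S. finite S \<and> S \<subseteq> E \<and> (\<forall>S'. finite S' \<longrightarrow> S \<subseteq> S' \<longrightarrow> S' \<subseteq> E \<longrightarrow> t = (\<Sum>e\<in>S'. tens e (sl (r e) t)))" for t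
  proof (induction t rule: tensor_induct)
    case (tens a b)
    let ?S = "{e. r e a \<noteq> 0}"
    have fin: "finite ?S" unfolding r_def by (rule vA.finite_representation)
    have sub: "?S \<subseteq> E" unfolding r_def using vA.representation_ne_zero by blast
    have "tens a b = (\<Sum>e\<in>S'. tens e (sl (r e) (tens a b)))" if "finite S'" "?S \<subseteq> S'" "S' \<subseteq> E" for S'
    proof -
      have "a = (\<Sum>e\<in>?S. sA (r e a) e)"
        unfolding r_def by (rule vA.sum_nonzero_representation_eq[symmetric]) (use E in auto)
      also have "\<dots> = (\<Sum>e\<in>S'. sA (r e a) e)"
        using that by (intro sum.mono_neutral_left) auto
      finally have a: "a = (\<Sum>e\<in>S'. sA (r e a) e)" .
      have "tens (\<Sum>e\<in>S'. sA (r e a) e) b = (\<Sum>e\<in>S'. tens e (sB (r e a) b))"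
        using that(1) by induction (auto simp: tens_add_left tens_scale_left tens_scale_right)
      then show ?thesis unfolding sl_tens[OF r] a[symmetric] .
    qed
    then show ?case using fin sub by blast
  next
    case (add s t)
    then obtain S T where
      "finite S" "S \<subseteq> E" "\<forall>S'. finite S' \<longrightarrow> S \<subseteq> S' \<longrightarrow> S' \<subseteq> E \<longrightarrow> s = (\<Sum>e\<in>S'. tens e (sl (r e) s))"
      "finite T" "T \<subseteq> E" "\<forall>S'. finite S' \<longrightarrow> T \<subseteq> S' \<longrightarrow> S' \<subseteq> E \<longrightarrow> t = (\<Sum>e\<in>S'. tens e (sl (r e) t))"
      by blast
    then show ?case
      by (intro exI[of _ "S \<union> T"]) (auto simp: sl_add[OF r] tens_add_right sum.distrib)
  qed
  then obtain S where "finite S" "S \<subseteq> E" "t = (\<Sum>e\<in>S. tens e (sl (r e) t))"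
    by (meson order_refl)
  then show ?thesis using assms[OF r] by simp
qed

text \<open>
  Slicing first on the right and then on the left gives the same scalars as in the other order.
\<close>

lemma eq_zero_if_slices_right_vanish:
  assumes "\<And>g. Vector_Spaces.linear sB (*) g \<Longrightarrow> sr g t = 0"
  shows "t = 0"
proof (rule eq_zero_if_slices_left_vanish)
  fix f assume f: "Vector_Spaces.linear sA (*) f"
  show "sl f t = 0"
    by (rule vB.eq_zero_if_functionals_vanish)
      (metis assms f functional_slices linearD(3))
qed

end

section \<open>Tensor products of non-degenerate algebras and their multipliers\<close>

lemma multiplier_eqI_right:
  fixes s :: "'k::field \<Rightarrow> 'a::ring \<Rightarrow> 'a" and m n :: "'a multiplier"
  assumes "k_algebra s" "\<And>x. app_r m x = app_r n x"
  shows "m = n"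
proof -
  interpret k_algebra s by fact
  have "x * (app_l m y - app_l n y) = 0" for x y
    by (simp add: right_diff_distrib app_assoc assms(2))
  then have "app_l m y = app_l n y" for y
    using nondegenerate_right[of "app_l m y - app_l n y"] by simp
  then show ?thesis using assms(2) by (auto intro!: multiplier_eqI)
qed

lemma multiplier_eqI_left:
  fixes s :: "'k::field \<Rightarrow> 'a::ring \<Rightarrow> 'a" and m n :: "'a multiplier"
  assumes "k_algebra s" "\<And>x. app_l m x = app_l n x"
  shows "m = n"
proof -
  interpret k_algebra s by fact
  have "(app_r m y - app_r n y) * x = 0" for x y
    by (simp add: left_diff_distrib app_assoc[symmetric] assms(2))
  then have "app_r m y = app_r n y" for y
    using nondegenerate_left[of "app_r m y - app_r n y"] by simp
  then show ?thesis using assms(2) by (auto intro!: multiplier_eqI)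
qed

lemma multiplier_existence:
  assumes "\<And>x y. L (x + y) = L x + L y" "\<And>x y. R (x + y) = R x + R y"
    and "\<And>x y. L (x * y) = L x * y" "\<And>x y. R (x * y) = x * R y"
    and "\<And>x y. x * L y = R x * y"
  obtains m :: "'a::ring multiplier" where "\<And>x. app_l m x = L x" "\<And>x. app_r m x = R x"
proof
  have *: "(L, R) \<in> {(L, R). (\<forall>x y. L (x + y) = L x + L y) \<and> (\<forall>x y. R (x + y) = R x + R y) \<and>
      (\<forall>x y. L (x * y) = L x * y) \<and> (\<forall>x y. R (x * y) = x * R y) \<and> (\<forall>x y. x * L y = R x * y)}"
    using assms by blast
  show "app_l (Abs_multiplier (L, R)) x = L x" "app_r (Abs_multiplier (L, R)) x = R x" for x
    by (simp_all add: app_l.rep_eq app_r.rep_eq Abs_multiplier_inverse[OF *])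
qed

lemma app_zero [simp]: "app_l m 0 = 0" "app_r m 0 = 0"
  using app_l_add[of m 0 0] app_r_add[of m 0 0] by simp_all

lemma emb_add: "emb (a + b) = emb a + emb b"
  by (rule multiplier_eqI) (auto simp: fun_eq_iff algebra_simps)

lemma emb_mult: "emb (a * b) = emb a * emb b"
  by (rule multiplier_eqI) (auto simp: fun_eq_iff mult.assoc)

lemma mult_emb: "m * emb a = emb (app_l m a)"
  by (rule multiplier_eqI) (auto simp: fun_eq_iff app_l_mult app_assoc)

lemma emb_mult_left: "emb a * m = emb (app_r m a)"
  by (rule multiplier_eqI) (auto simp: fun_eq_iff app_r_mult app_assoc)

lemma (in k_algebra) emb_eq_iff [simp]: "emb a = emb b \<longleftrightarrow> (a :: 'a) = b"
  using inj_emb by (auto dest: injD)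

lemma (in k_algebra) emb_scale: "emb (scale c a) = mscale scale c (emb a)"
  by (rule multiplier_eqI)
    (auto simp: fun_eq_iff mscale_def scale_mult_left[symmetric] scale_mult_right[symmetric])

lemma (in k_algebra) app_mscale [simp]:
  "app_l (mscale scale c m) x = scale c (app_l m x)" "app_r (mscale scale c m) x = scale c (app_r m x)"
  by (simp_all add: mscale_def app_r_scale)

lemma (in k_algebra) mscale_mult: "mscale scale c m * n = mscale scale c (m * n)"
  "m * mscale scale c n = mscale scale c (m * n)"
  by (rule multiplier_eqI; auto simp: fun_eq_iff app_l_scale app_r_scale)+

text \<open>
  The slices of \<open>t (a \<otimes> b)\<close> are \<open>(\<omega>(\<cdot> a) \<otimes> \<iota>)(t) b\<close>, so that non-degeneracy of the two factors
  carries over to the tensor product.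
\<close>

locale nondegenerate_tensor = algebra_tensor sA sB sT tens + A: k_algebra sA + B: k_algebra sB
  for sA :: "'k::field \<Rightarrow> 'a::ring \<Rightarrow> 'a"
    and sB :: "'k \<Rightarrow> 'b::ring \<Rightarrow> 'b"
    and sT :: "'k \<Rightarrow> 't::ring \<Rightarrow> 't"
    and tens :: "'a \<Rightarrow> 'b \<Rightarrow> 't"
begin

lemma linear_functional_mult:
  assumes "Vector_Spaces.linear sA (*) f"
  shows "Vector_Spaces.linear sA (*) (\<lambda>x. f (x * a))" "Vector_Spaces.linear sA (*) (\<lambda>x. f (a * x))"
  using assms by (auto simp: Vector_Spaces.linear_iff distrib_left distrib_right
    A.scale_mult_left[symmetric] A.scale_mult_right[symmetric])

lemma sl_mult_right:
  assumes f: "Vector_Spaces.linear sA (*) f"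
  shows "sl f (t * tens a b) = sl (\<lambda>x. f (x * a)) t * b"
  by (induction t rule: tensor_induct)
    (auto simp: tens_mult distrib_right B.scale_mult_left f sl_add[OF f]
      linear_functional_mult[OF f] sl_add[OF linear_functional_mult(1)[OF f]])

lemma sl_mult_left:
  assumes f: "Vector_Spaces.linear sA (*) f"
  shows "sl f (tens a b * t) = b * sl (\<lambda>x. f (a * x)) t"
  by (induction t rule: tensor_induct)
    (auto simp: tens_mult distrib_left B.scale_mult_right[symmetric] f sl_add[OF f]
      linear_functional_mult[OF f] sl_add[OF linear_functional_mult(2)[OF f]])

lemma tens_eq_zero_iff: "tens a b = 0 \<longleftrightarrow> a = 0 \<or> b = 0"
proof
  assume 0: "tens a b = 0"
  show "a = 0 \<or> b = 0"
  proof (rule ccontr)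
    assume *: "\<not> (a = 0 \<or> b = 0)"
    then obtain f where f: "Vector_Spaces.linear sA (*) f" "f a \<noteq> 0"
      using vA.eq_zero_if_functionals_vanish[of a] by blast
    have "sB (f a) b = 0" using sl_tens[OF f(1), of a b] 0 linearD(3)[OF linear_sl[OF f(1)]] by simp
    then show False using * f(2) by simp
  qed
qed auto

lemma mult_tens_eq_zero:
  assumes "\<And>a b. t * tens a b = 0"
  shows "t = 0"
proof (rule eq_zero_if_slices_right_vanish)
  fix g assume g: "Vector_Spaces.linear sB (*) g"
  have z: "sl (\<lambda>x. f (x * a)) t = 0" if f: "Vector_Spaces.linear sA (*) f" for f a
    by (rule B.nondegenerate_left)
     (use sl_mult_right[OF f, of t a] assms linearD(3)[OF linear_sl[OF f]] in simp)
  have "f (sr g t * a) = 0" if f: "Vector_Spaces.linear sA (*) f" for f a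
    using functional_slices[OF linear_functional_mult(1)[OF f, of a] g, of t] z[OF f] linearD(3)[OF g]
    by simp
  then show "sr g t = 0"
    by (metis vA.eq_zero_if_functionals_vanish A.nondegenerate_left)
qed

lemma tens_mult_eq_zero:
  assumes "\<And>a b. tens a b * t = 0"
  shows "t = 0"
proof (rule eq_zero_if_slices_right_vanish)
  fix g assume g: "Vector_Spaces.linear sB (*) g"
  have z: "sl (\<lambda>x. f (a * x)) t = 0" if f: "Vector_Spaces.linear sA (*) f" for f a
    by (rule B.nondegenerate_right)
     (use sl_mult_left[OF f, of a _ t] assms linearD(3)[OF linear_sl[OF f]] in simp)
  have "f (a * sr g t) = 0" if f: "Vector_Spaces.linear sA (*) f" for f a
    using functional_slices[OF linear_functional_mult(2)[OF f, of a] g, of t] z[OF f] linearD(3)[OF g]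
    by simp
  then show "sr g t = 0"
    by (metis vA.eq_zero_if_functionals_vanish A.nondegenerate_right)
qed

sublocale T: k_algebra sT
proof
  show "\<exists>t::'t. t \<noteq> 0" using A.nonzero B.nonzero tens_eq_zero_iff by blast
  have l: "sT c (tens a b) * t = sT c (tens a b * t)" for c a b t
    by (induction t rule: tensor_induct)
      (auto simp: tens_mult tens_scale_left[symmetric] A.scale_mult_left[symmetric] distrib_left
        vT.scale_right_distrib)
  show "sT c (s * t) = sT c s * t" for c s t
    by (induction s rule: tensor_induct) (auto simp: l distrib_right vT.scale_right_distrib)
  have r: "t * sT c (tens a b) = sT c (t * tens a b)" for c a b t
    by (induction t rule: tensor_induct)
      (auto simp: tens_mult tens_scale_left[symmetric] A.scale_mult_right[symmetric] distrib_right
        vT.scale_right_distrib)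
  show "sT c (s * t) = s * sT c t" for c s t
    by (induction t rule: tensor_induct) (auto simp: r distrib_left vT.scale_right_distrib)
  show "s = 0" if "\<And>t. s * t = 0" for s :: 't
    using that by (rule mult_tens_eq_zero)
  show "t = 0" if "\<And>s. s * t = 0" for t :: 't
    using that by (rule tens_mult_eq_zero)
qed

lemma app_mtens [simp]:
  shows "app_l (mtens tens m n) (tens a b) = tens (app_l m a) (app_l n b)"
    and "app_r (mtens tens m n) (tens a b) = tens (app_r m a) (app_r n b)"
proof -
  define L where "L = tensor_lift sT tens sT (\<lambda>a b. tens (app_l m a) (app_l n b))"
  define R where "R = tensor_lift sT tens sT (\<lambda>a b. tens (app_r m a) (app_r n b))"
  have bl: "bilinear_map sA sB sT (\<lambda>a b. tens (app_l m a) (app_l n b))"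
    by (intro bilinear_mapI)
      (auto simp: app_l_add tens_add_left tens_add_right A.app_l_scale B.app_l_scale
        tens_scale_left tens_scale_right intro: vT.vector_space_axioms)
  have br: "bilinear_map sA sB sT (\<lambda>a b. tens (app_r m a) (app_r n b))"
    by (intro bilinear_mapI)
      (auto simp: app_r_add tens_add_left tens_add_right A.app_r_scale B.app_r_scale
        tens_scale_left tens_scale_right intro: vT.vector_space_axioms)
  have L: "L (tens a b) = tens (app_l m a) (app_l n b)" for a b
    unfolding L_def by (rule tensor_lift_tens[OF bl])
  have R: "R (tens a b) = tens (app_r m a) (app_r n b)" for a b
    unfolding R_def by (rule tensor_lift_tens[OF br])
  have La: "L (s + t) = L s + L t" for s t
    unfolding L_def by (rule linearD(1)[OF linear_tensor_lift[OF bl]])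
  have Ra: "R (s + t) = R s + R t" for s t
    unfolding R_def by (rule linearD(1)[OF linear_tensor_lift[OF br]])
  have L1: "L (tens a b * t) = L (tens a b) * t" for a b t
    by (induction t rule: tensor_induct) (auto simp: tens_mult L La app_l_mult distrib_left)
  have Lm: "L (s * t) = L s * t" for s t
    by (induction s rule: tensor_induct) (auto simp: L1 La distrib_right)
  have R1: "R (tens a b * t) = tens a b * R t" for a b t
    by (induction t rule: tensor_induct) (auto simp: tens_mult R Ra app_r_mult distrib_left)
  have Rm: "R (s * t) = s * R t" for s t
    by (induction s rule: tensor_induct) (auto simp: R1 Ra distrib_right)
  have LR1: "tens a b * L t = R (tens a b) * t" for a b t
    by (induction t rule: tensor_induct) (auto simp: tens_mult L R La app_assoc distrib_left)
  have LR: "s * L t = R s * t" for s t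
    by (induction s rule: tensor_induct) (auto simp: LR1 Ra distrib_right)
  obtain p where p: "\<And>t. app_l p t = L t" "\<And>t. app_r p t = R t"
    using multiplier_existence[of L R] La Ra Lm Rm LR by metis
  have "mtens tens m n = p" unfolding mtens_def
  proof (rule the_equality)
    show "\<forall>x a. app_l p (tens x a) = tens (app_l m x) (app_l n a) \<and>
                app_r p (tens x a) = tens (app_r m x) (app_r n a)"
      by (simp add: p L R)
  next
    fix q assume q: "\<forall>x a. app_l q (tens x a) = tens (app_l m x) (app_l n a) \<and>
                app_r q (tens x a) = tens (app_r m x) (app_r n a)"
    show "q = p"
    proof (rule multiplier_eqI_left[OF T.k_algebra_axioms])
      show "app_l q t = app_l p t" for t
        by (induction t rule: tensor_induct) (auto simp: q p L app_l_add)
    qed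
  qed
  then show "app_l (mtens tens m n) (tens a b) = tens (app_l m a) (app_l n b)"
    "app_r (mtens tens m n) (tens a b) = tens (app_r m a) (app_r n b)"
    by (simp_all add: p L R)
qed

lemma multiplier_eq_tensI:
  assumes "\<And>a b. app_l p (tens a b) = app_l q (tens a b)"
  shows "p = q"
proof (rule multiplier_eqI_left[OF T.k_algebra_axioms])
  show "app_l p t = app_l q t" for t
    by (induction t rule: tensor_induct) (auto simp: assms app_l_add)
qed

lemma mtens_mult: "mtens tens m n * mtens tens m' n' = mtens tens (m * m') (n * n')"
  by (rule multiplier_eq_tensI) simp

lemma mtens_emb: "mtens tens (emb a) (emb b) = emb (tens a b)"
  by (rule multiplier_eq_tensI) (simp add: tens_mult)

lemma mtens_one [simp]: "mtens tens 1 1 = 1"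
  by (rule multiplier_eq_tensI) simp

lemma mtens_add: "mtens tens (m + m') n = mtens tens m n + mtens tens m' n"
  "mtens tens m (n + n') = mtens tens m n + mtens tens m n'"
  by (rule multiplier_eq_tensI; simp add: tens_add_left tens_add_right)+

lemma mtens_mscale: "mtens tens (mscale sA c m) n = mscale sT c (mtens tens m n)"
  "mtens tens m (mscale sB c n) = mscale sT c (mtens tens m n)"
  by (rule multiplier_eq_tensI; simp add: tens_scale_left tens_scale_right)+

definition map_right :: "('b \<Rightarrow> 'b) \<Rightarrow> 't \<Rightarrow> 't" where
  "map_right h = tensor_lift sT tens sT (\<lambda>a b. tens a (h b))"

context
  fixes h assumes h: "Vector_Spaces.linear sB sB h"
begin

lemma bilinear_map_right: "bilinear_map sA sB sT (\<lambda>a b. tens a (h b))"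
  by (rule bilinear_mapI) (auto simp: tens_bilinear linearD[OF h] intro: vT.vector_space_axioms)

lemma map_right_tens: "map_right h (tens a b) = tens a (h b)"
  unfolding map_right_def by (rule tensor_lift_tens[OF bilinear_map_right])

lemma linear_map_right: "Vector_Spaces.linear sT sT (map_right h)"
  unfolding map_right_def by (rule linear_tensor_lift[OF bilinear_map_right])

lemmas map_right_add = linearD(1)[OF linear_map_right]

end

lemma map_right_fun_add:
  assumes h: "Vector_Spaces.linear sB sB h" and h': "Vector_Spaces.linear sB sB h'"
  shows "map_right (\<lambda>b. h b + h' b) t = map_right h t + map_right h' t"
proof -
  have lin: "Vector_Spaces.linear sB sB (\<lambda>b. h b + h' b)"
    using h h' by (auto simp: Vector_Spaces.linear_iff vB.scale_right_distrib algebra_simps)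
  show ?thesis
    by (induction t rule: tensor_induct)
      (simp_all add: map_right_tens[OF h] map_right_tens[OF h'] map_right_tens[OF lin]
        map_right_add[OF h] map_right_add[OF h'] map_right_add[OF lin] tens_add_right algebra_simps)
qed

abbreviation "ml \<equiv> \<lambda>a. mtens tens (emb a) 1"
abbreviation "mr \<equiv> \<lambda>b. mtens tens 1 (emb b)"

lemma sl_app_mr:
  assumes "Vector_Spaces.linear sA (*) f"
  shows "sl f (app_l (mr b) t) = b * sl f t" "sl f (app_r (mr b) t) = sl f t * b"
  by (induction t rule: tensor_induct;
    simp add: assms app_l_add app_r_add sl_add[OF assms] distrib_left distrib_right
    B.scale_mult_left B.scale_mult_right[symmetric])+

lemma sr_app_ml:
  assumes "Vector_Spaces.linear sB (*) g"
  shows "sr g (app_l (ml a) t) = a * sr g t" "sr g (app_r (ml a) t) = sr g t * a"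
  by (induction t rule: tensor_induct;
    simp add: assms app_l_add app_r_add sr_add[OF assms] distrib_left distrib_right
    A.scale_mult_left A.scale_mult_right[symmetric])+

lemma cancel_ml:
  assumes "\<And>a. app_l (ml a) s = app_l (ml a) t"
  shows "s = t"
proof -
  have "sr g (s - t) = 0" if g: "Vector_Spaces.linear sB (*) g" for g
    by (rule A.nondegenerate_right)
      (metis assms g sr_app_ml(1)[OF g] linearD(4)[OF linear_sr[OF g]] right_diff_distrib right_minus_eq)
  then show ?thesis using eq_zero_if_slices_right_vanish[of "s - t"] by simp
qed

lemma cancel_mr:
  assumes "\<And>b. app_r (mr b) s = app_r (mr b) t"
  shows "s = t"
proof -
  have "sl f (s - t) = 0" if f: "Vector_Spaces.linear sA (*) f" for f
    by (rule B.nondegenerate_left)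
      (metis assms f sl_app_mr(2)[OF f] linearD(4)[OF linear_sl[OF f]] left_diff_distrib right_minus_eq)
  then show ?thesis using eq_zero_if_slices_left_vanish[of "s - t"] by simp
qed

end

text \<open>
  The multiplier has to send \<open>p\<^sub>i c\<close> to \<open>q\<^sub>i c\<close> and \<open>c p\<^sub>i\<close> to \<open>c r\<^sub>i\<close>, which fixes it when these
  elements span \<open>C\<close>. Compatibility gives \<open>(d p\<^sub>j) (q\<^sub>i c) = (d r\<^sub>j) (p\<^sub>i c)\<close>; hence a relation
  between the \<open>p\<^sub>i c\<close> holds between the \<open>q\<^sub>i c\<close> as well, because \<open>C\<close> is non-degenerate and the
  \<open>d p\<^sub>j\<close> span it.
\<close>

lemma multiplier_from_products:
  fixes sC :: "'k::field \<Rightarrow> 'c::ring \<Rightarrow> 'c" and p q r :: "'i \<Rightarrow> 'c multiplier"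
  assumes C: "k_algebra sC"
    and spanl: "module.span sC {app_l (p i) c | i c. True} = UNIV"
    and spanr: "module.span sC {app_r (p i) c | i c. True} = UNIV"
    and compatible: "\<And>i j. p i * q j = r i * p j"
  obtains n where "\<And>i. n * p i = q i" "\<And>i. p i * n = r i"
    "\<And>n'. (\<And>i. n' * p i = q i) \<Longrightarrow> n' = n"
proof -
  interpret C: k_algebra sC by fact
  have indl: "P c" if "\<And>i c. P (app_l (p i) c)" "\<And>c d. P c \<Longrightarrow> P d \<Longrightarrow> P (c + d)" for P c
  proof -
    have "c \<in> C.span {app_l (p i) c | i c. True}" using spanl by simp
    then show ?thesis
    proof (induction rule: C.span_induct_alt)
      case base then show ?case using that(1)[of _ 0] by simp
    next
      case (step k x y) then show ?case using that by (auto simp flip: C.app_l_scale)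
    qed
  qed
  have indr: "P c" if "\<And>i c. P (app_r (p i) c)" "\<And>c d. P c \<Longrightarrow> P d \<Longrightarrow> P (c + d)" for P c
  proof -
    have "c \<in> C.span {app_r (p i) c | i c. True}" using spanr by simp
    then show ?thesis
    proof (induction rule: C.span_induct_alt)
      case base then show ?case using that(1)[of _ 0] by simp
    next
      case (step k x y) then show ?case using that by (auto simp flip: C.app_r_scale)
    qed
  qed
  have bal: "app_r (p j) d * app_l (q i) c = app_r (r j) d * app_l (p i) c" for i j c d
    by (metis app_assoc app_ops(7) compatible)
  have nr: "e = e'" if "\<And>i d. app_r (p i) d * e = app_r (p i) d * e'" for e e'
  proof -
    have "x * (e - e') = 0" for x
      by (induction x rule: indr) (use that in \<open>auto simp: right_diff_distrib distrib_right\<close>)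
    then show ?thesis using C.nondegenerate_right[of "e - e'"] by simp
  qed
  have nl: "e = e'" if "\<And>i d. e * app_l (p i) d = e' * app_l (p i) d" for e e'
  proof -
    have "(e - e') * x = 0" for x
      by (induction x rule: indl) (use that in \<open>auto simp: left_diff_distrib distrib_left\<close>)
    then show ?thesis using C.nondegenerate_left[of "e - e'"] by simp
  qed
  have "\<exists>e. \<forall>j d. app_r (p j) d * e = app_r (r j) d * c" for c
  proof (induction c rule: indl)
    case (1 i c) then show ?case using bal by blast
  next
    case (2 c d) then show ?case by (metis distrib_left)
  qed
  then obtain L where L: "app_r (p j) d * L c = app_r (r j) d * c" for j d c by metis
  have "\<exists>e. \<forall>i d. e * app_l (p i) d = c * app_l (q i) d" for c
  proof (induction c rule: indr)
    case (1 i c) then show ?case using bal by metis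
  next
    case (2 c d) then show ?case by (metis distrib_right)
  qed
  then obtain R where R: "R c * app_l (p i) d = c * app_l (q i) d" for i d c by metis
  have Lp: "L (app_l (p i) c) = app_l (q i) c" for i c
    by (rule nr) (simp add: L bal)
  have Rp: "R (app_r (p i) c) = app_r (r i) c" for i c
    by (rule nl) (simp add: R bal)
  have La: "L (c + d) = L c + L d" for c d by (rule nr) (simp add: L distrib_left)
  have Ra: "R (c + d) = R c + R d" for c d by (rule nl) (simp add: R distrib_right)
  have Lm: "L (c * d) = L c * d" for c d by (rule nr) (metis L mult.assoc)
  have Rm: "R (c * d) = c * R d" for c d by (rule nl) (metis R mult.assoc)
  have LR: "c * L d = R c * d" for c d
  proof (induction c rule: indr)
    case (1 i c) then show ?case by (simp add: L Rp)
  next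
    case (2 c d) then show ?case by (simp add: distrib_right Ra)
  qed
  obtain n where n: "\<And>c. app_l n c = L c" "\<And>c. app_r n c = R c"
    using multiplier_existence[of L R] La Ra Lm Rm LR by metis
  show ?thesis
  proof
    show np: "n * p i = q i" for i
      by (rule multiplier_eqI_left[OF C]) (simp add: n Lp)
    show "p i * n = r i" for i
      by (rule multiplier_eqI_right[OF C]) (simp add: n Rp)
    show "n' = n" if "\<And>i. n' * p i = q i" for n'
    proof (rule multiplier_eqI_left[OF C])
      show "app_l n' c = app_l n c" for c
      proof (induction c rule: indl)
        case (1 i c) then show ?case by (metis that np app_ops(7))
      next
        case (2 c d) then show ?case by (simp add: app_l_add)
      qed
    qed
  qed
qed

text \<open>
  For a homomorphism \<open>f : B \<rightarrow> M(C)\<close> the prescribed products are \<open>n f(b) = f(m b)\<close> and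
  \<open>f(b) n = f(b m)\<close>; they are compatible because \<open>b (m b') = (b m) b'\<close>.
\<close>

lemma mult_ext_mult:
  fixes sC :: "'k::field \<Rightarrow> 'c::ring \<Rightarrow> 'c"
  assumes C: "k_algebra sC" and mult: "\<And>x y. f (x * y) = f x * f y"
    and "module.span sC {app_l (f b) c | b c. True} = UNIV"
    and "module.span sC {app_r (f b) c | b c. True} = UNIV"
  shows "mult_ext f m * f b = f (app_l m b)" "f b * mult_ext f m = f (app_r m b)"
proof -
  obtain n where n: "\<And>b. n * f b = f (app_l m b)" "\<And>b. f b * n = f (app_r m b)"
    "\<And>n'. (\<And>b. n' * f b = f (app_l m b)) \<Longrightarrow> n' = n"
    using multiplier_from_products[OF C assms(3,4), of "\<lambda>b. f (app_l m b)" "\<lambda>b. f (app_r m b)"]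
    by (metis app_assoc mult)
  have "mult_ext f m = n"
    unfolding mult_ext_def by (rule the_equality) (use n in auto)
  then show "mult_ext f m * f b = f (app_l m b)" "f b * mult_ext f m = f (app_r m b)"
    using n by auto
qed

section \<open>Coassociativity on elements\<close>

text \<open>
  The suffix names the side on which \<open>f(x)\<close> is multiplied by an element of one of the two algebras, and
  the leg of the tensor product in which that element sits. The products are meant to lie in the tensor
  product itself; \<open>inv emb\<close> has an arbitrary value otherwise.
\<close>

definition cover_r2 :: "('x::ring \<Rightarrow> 'a::ring \<Rightarrow> 't::ring) \<Rightarrow> ('c \<Rightarrow> 't multiplier) \<Rightarrow> 'c \<Rightarrow> 'a \<Rightarrow> 't" where
  "cover_r2 tens f x a = inv emb (f x * mtens tens 1 (emb a))"
definition cover_l2 :: "('x::ring \<Rightarrow> 'a::ring \<Rightarrow> 't::ring) \<Rightarrow> ('c \<Rightarrow> 't multiplier) \<Rightarrow> 'a \<Rightarrow> 'c \<Rightarrow> 't" where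
  "cover_l2 tens f a x = inv emb (mtens tens 1 (emb a) * f x)"
definition cover_r1 :: "('x::ring \<Rightarrow> 'a::ring \<Rightarrow> 't::ring) \<Rightarrow> ('c \<Rightarrow> 't multiplier) \<Rightarrow> 'c \<Rightarrow> 'x \<Rightarrow> 't" where
  "cover_r1 tens f x a = inv emb (f x * mtens tens (emb a) 1)"
definition cover_l1 :: "('x::ring \<Rightarrow> 'a::ring \<Rightarrow> 't::ring) \<Rightarrow> ('c \<Rightarrow> 't multiplier) \<Rightarrow> 'x \<Rightarrow> 'c \<Rightarrow> 't" where
  "cover_l1 tens f a x = inv emb (mtens tens (emb a) 1 * f x)"

lemma emb_inv_emb: "m \<in> range emb \<Longrightarrow> emb (inv emb m) = m"
  by (rule f_inv_into_f)

context k_algebra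
begin

lemma inv_emb_emb [simp]: "inv emb (emb (a :: 'a)) = a"
  by (rule inv_f_f[OF inj_emb])

lemma inv_emb_add:
  fixes m n :: "'a multiplier"
  assumes "m \<in> range emb" "n \<in> range emb"
  shows "inv emb (m + n) = inv emb m + inv emb n"
  using assms by (auto simp flip: emb_add)

lemma inv_emb_mscale:
  fixes m :: "'a multiplier"
  assumes "m \<in> range emb"
  shows "inv emb (mscale scale c m) = scale c (inv emb m)"
  using assms by (auto simp flip: emb_scale)

end

lemma bilinear_map_inv_emb:
  assumes W: "k_algebra sW" and f: "bilinear_map sA sB (mscale sW) f"
    and range: "\<And>a b. f a b \<in> range emb"
  shows "bilinear_map sA sB sW (\<lambda>a b. inv emb (f a b))"
proof -
  interpret W: k_algebra sW by fact
  show ?thesis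
    using f W.vector_space_axioms
    by (simp add: bilinear_map_def Vector_Spaces.linear_iff W.inv_emb_add W.inv_emb_mscale range)
qed

lemma (in nondegenerate_tensor) bilinear_multiplier_products:
  assumes "Vector_Spaces.linear sC (mscale sT) f"
  shows "bilinear_map sC sB (mscale sT) (\<lambda>x b. f x * mr b)"
    and "bilinear_map sA sC (mscale sT) (\<lambda>a x. ml a * f x)"
    and "bilinear_map sC sA (mscale sT) (\<lambda>x a. f x * ml a)"
    and "bilinear_map sB sC (mscale sT) (\<lambda>b x. mr b * f x)"
  using assms vA.vector_space_axioms vB.vector_space_axioms
  by (simp_all add: bilinear_map_def Vector_Spaces.linear_iff distrib_left distrib_right
    T.mscale_mult mtens_add mtens_mscale emb_add A.emb_scale B.emb_scale)

text \<open>
  Turns the bijectivity conditions on maps into \<open>range emb\<close> into bijectivity of maps between the tensor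
  products themselves.
\<close>

lemma (in tensor_product) bijective_onto_tensorD:
  fixes sW :: "'k \<Rightarrow> 'w::ring \<Rightarrow> 'w"
  assumes W: "k_algebra sW" and f: "bilinear_map sA sB (mscale sW) f"
    and bij: "bijective_onto_tensor sT tens sW f"
  shows "f a b \<in> range emb" and "bilinear_map sA sB sW (\<lambda>a b. inv emb (f a b))"
    and "bij (tensor_lift sT tens sW (\<lambda>a b. inv emb (f a b)))"
proof -
  interpret W: k_algebra sW by fact
  define F where "F = tensor_lift sT tens (mscale sW) f"
  have F: "bij_betw F UNIV (range emb)" using bij by (simp add: bijective_onto_tensor_def F_def)
  have F_tens: "F (tens a b) = f a b" for a b unfolding F_def by (rule tensor_lift_tens[OF f])
  have linF: "Vector_Spaces.linear sT (mscale sW) F"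
    unfolding F_def by (rule linear_tensor_lift[OF f])
  have range: "F t \<in> range emb" for t using F by (auto simp: bij_betw_def)
  show rf: "f a b \<in> range emb" for a b using range[of "tens a b"] F_tens by simp
  show bil: "bilinear_map sA sB sW (\<lambda>a b. inv emb (f a b))"
    by (rule bilinear_map_inv_emb[OF W f rf])
  have "tensor_lift sT tens sW (\<lambda>a b. inv emb (f a b)) = inv emb \<circ> F"
  proof
    show "tensor_lift sT tens sW (\<lambda>a b. inv emb (f a b)) t = (inv emb \<circ> F) t" for t
      by (induction t rule: tensor_induct)
        (simp_all add: tensor_lift_tens[OF bil] F_tens linearD[OF linear_tensor_lift[OF bil]]
          linearD[OF linF] W.inv_emb_add range)
  qed
  moreover have "bij_betw (inv emb :: _ \<Rightarrow> 'w) (range emb) UNIV"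
    by (rule bij_betw_inv_into[OF inj_on_imp_bij_betw[OF W.inj_emb]])
  ultimately show "bij (tensor_lift sT tens sW (\<lambda>a b. inv emb (f a b)))"
    using bij_betw_trans[OF F] by metis
qed

definition idempotent_algebra :: "('k::field \<Rightarrow> 'a::ring \<Rightarrow> 'a) \<Rightarrow> bool" where
  "idempotent_algebra s \<longleftrightarrow> module.span s {a * b | a b. True} = UNIV"

text \<open>
  Idempotency is handled through functionals: \<open>A\<close> is spanned by products iff the only functional that
  kills all products is zero. In this form it combines well with slices.
\<close>

lemma (in k_algebra) idempotent_algebraI:
  assumes "\<And>g x. Vector_Spaces.linear scale (*) g \<Longrightarrow> (\<And>a b. g (a * b) = 0) \<Longrightarrow> g x = 0"
  shows "idempotent_algebra scale"
  unfolding idempotent_algebra_def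
proof (rule span_eq_UNIV_if_functionals_vanish)
  fix g x assume g: "Vector_Spaces.linear scale (*) g"
    and 0: "\<And>y. y \<in> {a * b | a b. True} \<Longrightarrow> g y = 0"
  have "g (a * b) = 0" for a b by (rule 0) blast
  then show "g x = 0" by (rule assms[OF g])
qed

lemma (in k_algebra) idempotent_algebraD:
  assumes "idempotent_algebra scale" "Vector_Spaces.linear scale (*) g" "\<And>a b. g (a * b) = 0"
  shows "g x = 0"
  by (rule functional_vanishes_if_span_eq_UNIV[OF assms(1)[unfolded idempotent_algebra_def] assms(2)])
    (use assms(3) in auto)

locale nondegenerate_triple_tensor = triple_tensor sX sA sB sXA tXA sAB tAB sU tL tR +
  X: k_algebra sX + A: k_algebra sA + B: k_algebra sB
  for sX :: "'k::field \<Rightarrow> 'x::ring \<Rightarrow> 'x"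
    and sA :: "'k \<Rightarrow> 'a::ring \<Rightarrow> 'a"
    and sB :: "'k \<Rightarrow> 'b::ring \<Rightarrow> 'b"
    and sXA :: "'k \<Rightarrow> 'xa::ring \<Rightarrow> 'xa" and tXA :: "'x \<Rightarrow> 'a \<Rightarrow> 'xa"
    and sAB :: "'k \<Rightarrow> 'ab::ring \<Rightarrow> 'ab" and tAB :: "'a \<Rightarrow> 'b \<Rightarrow> 'ab"
    and sU :: "'k \<Rightarrow> 'u::ring \<Rightarrow> 'u" and tL :: "'xa \<Rightarrow> 'b \<Rightarrow> 'u" and tR :: "'x \<Rightarrow> 'ab \<Rightarrow> 'u"
begin

sublocale XA: nondegenerate_tensor sX sA sXA tXA by unfold_locales
sublocale AB: nondegenerate_tensor sA sB sAB tAB by unfold_locales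
sublocale L: nondegenerate_tensor sXA sB sU tL by unfold_locales
sublocale R: nondegenerate_tensor sX sAB sU tR by unfold_locales

lemma mtens_assoc: "mtens tL (mtens tXA m n) p = mtens tR m (mtens tAB n p)"
proof (rule L.multiplier_eq_tensI)
  have l: "app_l (mtens tL (mtens tXA m n) p) (tL (tXA x a) b) = tR (app_l m x) (tAB (app_l n a) (app_l p b))"
    for x a b
    by (simp only: L.app_mtens XA.app_mtens) (simp only: assoc)
  have r: "app_l (mtens tR m (mtens tAB n p)) (tL (tXA x a) b) = tR (app_l m x) (tAB (app_l n a) (app_l p b))"
    for x a b
    by (simp only: assoc) (simp only: R.app_mtens AB.app_mtens)
  show "app_l (mtens tL (mtens tXA m n) p) (tL z b) = app_l (mtens tR m (mtens tAB n p)) (tL z b)" for z b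
    by (induction z rule: XA.tensor_induct) (simp_all only: l r L.tens_add_left app_l_add)
qed

lemma L_sr_tR:
  assumes "Vector_Spaces.linear sB (*) \<theta>"
  shows "L.sr \<theta> (tR x w) = tXA x (AB.sr \<theta> w)"
  by (induction w rule: AB.tensor_induct)
    (simp_all add: assoc[symmetric] assms R.tens_add_right L.sr_add[OF assms] AB.sr_add[OF assms]
      XA.tens_add_right XA.tens_scale_right)

lemma R_sl_tL:
  assumes "Vector_Spaces.linear sX (*) \<omega>"
  shows "R.sl \<omega> (tL z b) = tAB (XA.sl \<omega> z) b"
  by (induction z rule: XA.tensor_induct)
    (simp_all add: assoc assms L.tens_add_left R.sl_add[OF assms] XA.sl_add[OF assms]
      AB.tens_add_left AB.tens_scale_left)

end

text \<open>
  The properties that \<open>\<alpha>\<close> on \<open>X\<close> shares with \<open>\<Delta>\<close> on \<open>A\<close>, both of which are instances of this locale.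
  Idempotency is a consequence of the non-degeneracy of \<open>\<Delta>\<close> for \<open>A\<close>, and of the surjectivity of the
  Galois map for \<open>X\<close>. That of \<open>X\<close> makes the homomorphism \<open>\<iota> \<otimes> \<Delta>\<close> non-degenerate, so that it extends to
  multipliers; that of \<open>A\<close> lets the products with all \<open>1 \<otimes> 1 \<otimes> a\<close> determine a multiplier.
\<close>

locale reduced_coaction = nondegenerate_triple_tensor sX sA sA sXA tXA sAA tAA sU tL tR
  for sX :: "'k::field \<Rightarrow> 'x::ring \<Rightarrow> 'x"
    and sA :: "'k \<Rightarrow> 'a::ring \<Rightarrow> 'a"
    and sXA :: "'k \<Rightarrow> 'xa::ring \<Rightarrow> 'xa" and tXA :: "'x \<Rightarrow> 'a \<Rightarrow> 'xa"
    and sAA :: "'k \<Rightarrow> 'aa::ring \<Rightarrow> 'aa" and tAA :: "'a \<Rightarrow> 'a \<Rightarrow> 'aa"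
    and sU :: "'k \<Rightarrow> 'u::ring \<Rightarrow> 'u" and tL :: "'xa \<Rightarrow> 'a \<Rightarrow> 'u" and tR :: "'x \<Rightarrow> 'aa \<Rightarrow> 'u" +
  fixes \<Delta> :: "'a \<Rightarrow> 'aa multiplier" and \<alpha> :: "'x \<Rightarrow> 'xa multiplier"
  assumes hom_\<Delta>: "algebra_hom sA (mscale sAA) \<Delta>"
    and covers_\<Delta>_r: "\<Delta> a * mtens tAA 1 (emb b) \<in> range emb"
    and covers_\<Delta>_l: "mtens tAA 1 (emb b) * \<Delta> a \<in> range emb"
    and span_\<Delta>_l: "module.span sAA {app_l (\<Delta> a) z | a z. True} = UNIV"
    and span_\<Delta>_r: "module.span sAA {app_r (\<Delta> a) z | a z. True} = UNIV"
    and hom_\<alpha>: "algebra_hom sX (mscale sXA) \<alpha>"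
    and covers_\<alpha>_r: "\<alpha> x * mtens tXA 1 (emb a) \<in> range emb"
    and covers_\<alpha>_l: "mtens tXA 1 (emb a) * \<alpha> x \<in> range emb"
    and reduced_\<alpha>: "mtens tXA (emb x) 1 * \<alpha> y \<in> range emb"
    and coassociative: "coassociative sXA tXA sU tL tR \<alpha> \<Delta>"
    and idempotent_A: "idempotent_algebra sA"
    and idempotent_X: "idempotent_algebra sX"
begin

lemma linear_\<Delta>: "Vector_Spaces.linear sA (mscale sAA) \<Delta>" and \<Delta>_mult: "\<Delta> (a * b) = \<Delta> a * \<Delta> b"
  using hom_\<Delta> by (auto simp: algebra_hom_def)
lemma linear_\<alpha>: "Vector_Spaces.linear sX (mscale sXA) \<alpha>"
  using hom_\<alpha> by (auto simp: algebra_hom_def)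

abbreviation "\<iota>\<Delta> \<equiv> id_tens_hom sXA tXA sU tR \<Delta>"
abbreviation "\<alpha>\<iota> \<equiv> hom_tens_id sXA tXA sU tL \<alpha>"

lemma bilinear_\<iota>\<Delta>: "bilinear_map sX sA (mscale sU) (\<lambda>x a. mtens tR (emb x) (\<Delta> a))"
  by (intro XA.bilinear_mapI)
    (auto simp: emb_add R.mtens_add R.mtens_mscale X.emb_scale linearD[OF linear_\<Delta>]
      intro: L.T.vector_space_mscale)

lemma bilinear_\<alpha>\<iota>: "bilinear_map sX sA (mscale sU) (\<lambda>x a. mtens tL (\<alpha> x) (emb a))"
  by (intro XA.bilinear_mapI)
    (auto simp: emb_add L.mtens_add L.mtens_mscale A.emb_scale linearD[OF linear_\<alpha>]
      intro: L.T.vector_space_mscale)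

lemma \<iota>\<Delta>_tens: "\<iota>\<Delta> (tXA x a) = mtens tR (emb x) (\<Delta> a)"
  unfolding id_tens_hom_def by (rule XA.tensor_lift_tens[OF bilinear_\<iota>\<Delta>])

lemma \<alpha>\<iota>_tens: "\<alpha>\<iota> (tXA x a) = mtens tL (\<alpha> x) (emb a)"
  unfolding hom_tens_id_def by (rule XA.tensor_lift_tens[OF bilinear_\<alpha>\<iota>])

lemma \<iota>\<Delta>_add: "\<iota>\<Delta> (s + t) = \<iota>\<Delta> s + \<iota>\<Delta> t"
  unfolding id_tens_hom_def by (rule linearD(1)[OF XA.linear_tensor_lift[OF bilinear_\<iota>\<Delta>]])

lemma \<alpha>\<iota>_add: "\<alpha>\<iota> (s + t) = \<alpha>\<iota> s + \<alpha>\<iota> t"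
  unfolding hom_tens_id_def by (rule linearD(1)[OF XA.linear_tensor_lift[OF bilinear_\<alpha>\<iota>]])

lemma \<iota>\<Delta>_mult: "\<iota>\<Delta> (s * t) = \<iota>\<Delta> s * \<iota>\<Delta> t"
proof -
  have 1: "\<iota>\<Delta> (tXA x a * t) = \<iota>\<Delta> (tXA x a) * \<iota>\<Delta> t" for x a t
    by (induction t rule: XA.tensor_induct)
      (auto simp: XA.tens_mult \<iota>\<Delta>_tens \<iota>\<Delta>_add R.mtens_mult emb_mult \<Delta>_mult distrib_left)
  show ?thesis
    by (induction s rule: XA.tensor_induct) (auto simp: 1 distrib_right \<iota>\<Delta>_add)
qed

lemma \<alpha>\<iota>_mult_mr: "\<alpha>\<iota> t * L.mr a = \<alpha>\<iota> (app_r (XA.mr a) t)"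
  by (induction t rule: XA.tensor_induct)
    (auto simp: \<alpha>\<iota>_tens \<alpha>\<iota>_add L.mtens_mult emb_mult distrib_right app_r_add)

lemma mr_mult_\<alpha>\<iota>: "L.mr a * \<alpha>\<iota> t = \<alpha>\<iota> (app_l (XA.mr a) t)"
  by (induction t rule: XA.tensor_induct)
    (auto simp: \<alpha>\<iota>_tens \<alpha>\<iota>_add L.mtens_mult emb_mult distrib_left app_l_add)

lemma mr_mult_\<iota>\<Delta>: "mtens tR 1 (\<Delta> a) * \<iota>\<Delta> t = \<iota>\<Delta> (app_l (XA.mr a) t)"
  by (induction t rule: XA.tensor_induct)
    (auto simp: \<iota>\<Delta>_tens \<iota>\<Delta>_add R.mtens_mult \<Delta>_mult distrib_left app_l_add)

lemma linear_compose_functional: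
  assumes "Vector_Spaces.linear sU (*) g"
  shows "Vector_Spaces.linear sA (*) (\<lambda>a. g (tL z a))" "Vector_Spaces.linear sX (*) (\<lambda>x. g (tR x w))"
    "Vector_Spaces.linear sAA (*) (\<lambda>w. g (tR x w))"
  using assms by (auto simp: Vector_Spaces.linear_iff XA.vA.vector_space_axioms XA.vB.vector_space_axioms
    AB.vT.vector_space_axioms L.tens_add_right L.tens_scale_right R.tens_add_left R.tens_add_right
    R.tens_scale_left R.tens_scale_right)

lemma functional_on_U_eq_zero:
  assumes g: "Vector_Spaces.linear sU (*) g" and "\<And>x w. g (tR x w) = 0"
  shows "g u = 0"
  by (induction u rule: R.tensor_induct) (auto simp: assms(2) linearD[OF g])

lemma span_\<iota>\<Delta>_l: "module.span sU {app_l (\<iota>\<Delta> t) u | t u. True} = UNIV"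
proof (rule L.vT.span_eq_UNIV_if_functionals_vanish)
  fix g u assume g: "Vector_Spaces.linear sU (*) g"
    and 0: "\<And>y. y \<in> {app_l (\<iota>\<Delta> t) u | t u. True} \<Longrightarrow> g y = 0"
  note lin = linear_compose_functional[OF g]
  have "g (app_l (\<iota>\<Delta> (tXA x a)) (tR y w)) = 0" for x y a w
    by (rule 0) blast
  then have 1: "g (tR (x * y) (app_l (\<Delta> a) w)) = 0" for x y a w
    by (simp add: \<iota>\<Delta>_tens)
  have 2: "g (tR (x * y) w) = 0" for x y w
    by (rule AB.vT.functional_vanishes_if_span_eq_UNIV[OF span_\<Delta>_l lin(3)]) (use 1 in auto)
  have "g (tR x w) = 0" for x w
    by (rule X.idempotent_algebraD[OF idempotent_X lin(2)]) (rule 2)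
  then show "g u = 0" by (rule functional_on_U_eq_zero[OF g])
qed

lemma span_\<iota>\<Delta>_r: "module.span sU {app_r (\<iota>\<Delta> t) u | t u. True} = UNIV"
proof (rule L.vT.span_eq_UNIV_if_functionals_vanish)
  fix g u assume g: "Vector_Spaces.linear sU (*) g"
    and 0: "\<And>y. y \<in> {app_r (\<iota>\<Delta> t) u | t u. True} \<Longrightarrow> g y = 0"
  note lin = linear_compose_functional[OF g]
  have "g (app_r (\<iota>\<Delta> (tXA y a)) (tR x w)) = 0" for x y a w
    by (rule 0) blast
  then have 1: "g (tR (x * y) (app_r (\<Delta> a) w)) = 0" for x y a w
    by (simp add: \<iota>\<Delta>_tens)
  have 2: "g (tR (x * y) w) = 0" for x y w
    by (rule AB.vT.functional_vanishes_if_span_eq_UNIV[OF span_\<Delta>_r lin(3)]) (use 1 in auto)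
  have "g (tR x w) = 0" for x w
    by (rule X.idempotent_algebraD[OF idempotent_X lin(2)]) (rule 2)
  then show "g u = 0" by (rule functional_on_U_eq_zero[OF g])
qed

lemma functional_on_U_eq_zero':
  assumes g: "Vector_Spaces.linear sU (*) g" and 0: "\<And>z a b. g (tL z (a * b)) = 0"
  shows "g u = 0"
proof -
  have "g (tL z a) = 0" for z a
    by (rule A.idempotent_algebraD[OF idempotent_A linear_compose_functional(1)[OF g]]) (rule 0)
  then show ?thesis
    by (induction u rule: L.tensor_induct) (auto simp: linearD[OF g])
qed

lemma span_mr:
  "module.span sU {app_l (L.mr a) u | a u. True} = UNIV"
  "module.span sU {app_r (L.mr a) u | a u. True} = UNIV"
proof -
  show "L.vT.span {app_l (L.mr a) u | a u. True} = UNIV"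
  proof (rule L.vT.span_eq_UNIV_if_functionals_vanish)
    fix g u assume g: "Vector_Spaces.linear sU (*) g"
      and 0: "\<And>y. y \<in> {app_l (L.mr a) u | a u. True} \<Longrightarrow> g y = 0"
    have "g (app_l (L.mr a) (tL z b)) = 0" for z a b by (rule 0) blast
    then show "g u = 0" by - (rule functional_on_U_eq_zero'[OF g], simp)
  qed
  show "L.vT.span {app_r (L.mr a) u | a u. True} = UNIV"
  proof (rule L.vT.span_eq_UNIV_if_functionals_vanish)
    fix g u assume g: "Vector_Spaces.linear sU (*) g"
      and 0: "\<And>y. y \<in> {app_r (L.mr a) u | a u. True} \<Longrightarrow> g y = 0"
    have "g (app_r (L.mr b) (tL z a)) = 0" for z a b by (rule 0) blast
    then show "g u = 0" by - (rule functional_on_U_eq_zero'[OF g], simp)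
  qed
qed

lemma emb_cover_\<alpha>:
  shows "emb (cover_r2 tXA \<alpha> x a) = \<alpha> x * XA.mr a" "emb (cover_l2 tXA \<alpha> a x) = XA.mr a * \<alpha> x"
    and "emb (cover_l1 tXA \<alpha> y x) = XA.ml y * \<alpha> x"
  by (simp_all add: cover_r2_def cover_l2_def cover_l1_def emb_inv_emb covers_\<alpha>_r covers_\<alpha>_l reduced_\<alpha>)

lemma emb_cover_\<Delta>:
  shows "emb (cover_r2 tAA \<Delta> x a) = \<Delta> x * AB.mr a" "emb (cover_l2 tAA \<Delta> a x) = AB.mr a * \<Delta> x"
  by (simp_all add: cover_r2_def cover_l2_def emb_inv_emb covers_\<Delta>_r covers_\<Delta>_l)

lemma mr_cover_r2: "app_l (XA.mr b) (cover_r2 tXA \<alpha> x a) = app_r (XA.mr a) (cover_l2 tXA \<alpha> b x)"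
  by (simp flip: XA.T.emb_eq_iff mult_emb emb_mult_left add: emb_cover_\<alpha> mult.assoc)

text \<open>
  Both sides of coassociativity are definite descriptions. By \<open>multiplier_from_products\<close> each of them
  is satisfied by exactly one multiplier, so a single multiplier \<open>n\<close> of \<open>X \<otimes> A \<otimes> A\<close> has the defining
  products of \<open>(\<alpha> \<otimes> \<iota>)\<alpha>(x)\<close> with the \<open>1 \<otimes> 1 \<otimes> a\<close> and those of \<open>(\<iota> \<otimes> \<Delta>)\<alpha>(x)\<close> with the
  \<open>(\<iota> \<otimes> \<Delta>)(t)\<close>.
\<close>

lemma coassociative_mult:
  shows "mult_ext \<iota>\<Delta> (\<alpha> x) * L.mr a = \<alpha>\<iota> (cover_r2 tXA \<alpha> x a)"
    and "\<iota>\<Delta> t * mult_ext \<iota>\<Delta> (\<alpha> x) = \<iota>\<Delta> (app_r (\<alpha> x) t)"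
proof -
  have compat: "L.mr b * \<alpha>\<iota> (cover_r2 tXA \<alpha> x a) = \<alpha>\<iota> (cover_l2 tXA \<alpha> b x) * L.mr a" for a b
    by (simp add: mr_mult_\<alpha>\<iota> \<alpha>\<iota>_mult_mr mr_cover_r2)
  obtain n where n: "\<And>a. n * L.mr a = \<alpha>\<iota> (cover_r2 tXA \<alpha> x a)"
    "\<And>a. L.mr a * n = \<alpha>\<iota> (cover_l2 tXA \<alpha> a x)"
    "\<And>n'. (\<And>a. n' * L.mr a = \<alpha>\<iota> (cover_r2 tXA \<alpha> x a)) \<Longrightarrow> n' = n"
    using multiplier_from_products[OF L.T.k_algebra_axioms span_mr, of "\<lambda>a. \<alpha>\<iota> (cover_r2 tXA \<alpha> x a)"
      "\<lambda>a. \<alpha>\<iota> (cover_l2 tXA \<alpha> a x)"] compat by blast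
  have "hom_tens_id_ext sXA tXA sU tL \<alpha> (\<alpha> x) = n"
    unfolding hom_tens_id_ext_def cover_r2_def[symmetric] cover_l2_def[symmetric]
    by (rule the_equality) (use n in auto)
  then have "mult_ext \<iota>\<Delta> (\<alpha> x) = n"
    using coassociative by (simp add: coassociative_def)
  then show "mult_ext \<iota>\<Delta> (\<alpha> x) * L.mr a = \<alpha>\<iota> (cover_r2 tXA \<alpha> x a)" using n(1) by simp
  show "\<iota>\<Delta> t * mult_ext \<iota>\<Delta> (\<alpha> x) = \<iota>\<Delta> (app_r (\<alpha> x) t)"
    by (rule mult_ext_mult(2)[OF L.T.k_algebra_axioms \<iota>\<Delta>_mult span_\<iota>\<Delta>_l span_\<iota>\<Delta>_r])
qed

lemma cancel_mtens_\<Delta>: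
  assumes "\<And>a. mtens tR 1 (\<Delta> a) * m = mtens tR 1 (\<Delta> a) * n"
  shows "m = n"
proof (rule multiplier_eqI_right[OF L.T.k_algebra_axioms])
  have *: "app_r m (tR x (app_r (\<Delta> a) w)) = app_r n (tR x (app_r (\<Delta> a) w))" for x a w
    using arg_cong[OF assms[of a], of "\<lambda>m. app_r m (tR x w)"] by simp
  have "app_r m (tR x w) - app_r n (tR x w) = 0" for x w
  proof -
    have "w \<in> AB.vT.span {app_r (\<Delta> a) z | a z. True}" using span_\<Delta>_r by simp
    then show ?thesis
      by (induction rule: AB.vT.span_induct_alt)
        (auto simp: * R.tens_add_right app_r_add R.tens_scale_right L.T.app_r_scale)
  qed
  then show "app_r m u = app_r n u" for u
    by (induction u rule: R.tensor_induct) (auto simp: app_r_add)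
qed

text \<open>
  Formally this is the value of the extension of \<open>\<iota> \<otimes> \<Delta>\<close> at the element \<open>(y \<otimes> 1) \<alpha>(x)\<close>. Only products
  with \<open>(\<iota> \<otimes> \<Delta>)(y \<otimes> a)\<close> are prescribed, and these contain the factor \<open>1 \<otimes> \<Delta>(a)\<close>, which can be
  cancelled since \<open>A \<otimes> A\<close> is spanned by \<open>(A \<otimes> A) \<Delta>(A)\<close>.
\<close>

lemma ml_mult_ext: "mtens tR (emb y) 1 * mult_ext \<iota>\<Delta> (\<alpha> x) = \<iota>\<Delta> (cover_l1 tXA \<alpha> y x)"
proof (rule cancel_mtens_\<Delta>)
  fix a
  have 1: "mtens tR 1 (\<Delta> a) * mtens tR (emb y) 1 = \<iota>\<Delta> (tXA y a)"
    by (simp add: R.mtens_mult \<iota>\<Delta>_tens)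
  have "emb (app_r (\<alpha> x) (tXA y a)) = XA.mr a * XA.ml y * \<alpha> x"
    by (simp add: emb_mult_left[symmetric] XA.mtens_emb[symmetric] XA.mtens_mult)
  also have "\<dots> = emb (app_l (XA.mr a) (cover_l1 tXA \<alpha> y x))"
    by (simp add: emb_cover_\<alpha> mult.assoc flip: mult_emb)
  finally have 2: "app_r (\<alpha> x) (tXA y a) = app_l (XA.mr a) (cover_l1 tXA \<alpha> y x)" by simp
  show "mtens tR 1 (\<Delta> a) * (mtens tR (emb y) 1 * mult_ext \<iota>\<Delta> (\<alpha> x))
      = mtens tR 1 (\<Delta> a) * \<iota>\<Delta> (cover_l1 tXA \<alpha> y x)"
    by (simp only: mult.assoc[symmetric] 1 coassociative_mult(2) 2 mr_mult_\<iota>\<Delta>)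
qed

lemma bilinear_covers_\<alpha>:
  shows "bilinear_map sX sA sXA (cover_r2 tXA \<alpha>)" "bilinear_map sX sX sXA (cover_l1 tXA \<alpha>)"
  unfolding cover_r2_def cover_l1_def
  by (rule bilinear_map_inv_emb[OF XA.T.k_algebra_axioms];
    rule XA.bilinear_multiplier_products[OF linear_\<alpha>] covers_\<alpha>_r reduced_\<alpha>)+

lemma bilinear_covers_\<Delta>:
  shows "bilinear_map sA sA sAA (cover_r2 tAA \<Delta>)" "bilinear_map sA sA sAA (cover_l2 tAA \<Delta>)"
  unfolding cover_r2_def cover_l2_def
  by (rule bilinear_map_inv_emb[OF AB.T.k_algebra_axioms];
    rule AB.bilinear_multiplier_products[OF linear_\<Delta>] covers_\<Delta>_r covers_\<Delta>_l)+

text \<open>\<open>V\<^sub>y \<otimes> \<iota>\<close> for \<open>V\<^sub>y x = (y \<otimes> 1) \<alpha>(x)\<close>, and \<open>\<iota> \<otimes> T\<^sub>a\<close> for \<open>T\<^sub>a b = \<Delta>(b) (1 \<otimes> a)\<close> or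
  \<open>T\<^sub>a b = (1 \<otimes> a) \<Delta>(b)\<close>.\<close>

definition "V_id y = tensor_lift sXA tXA sU (\<lambda>x b. tL (cover_l1 tXA \<alpha> y x) b)"
definition "id_T a = tensor_lift sXA tXA sU (\<lambda>x b. tR x (cover_r2 tAA \<Delta> b a))"
definition "id_T' a = tensor_lift sXA tXA sU (\<lambda>x b. tR x (cover_l2 tAA \<Delta> a b))"

lemma
  shows V_id_tens: "V_id y (tXA x b) = tL (cover_l1 tXA \<alpha> y x) b"
    and linear_V_id: "Vector_Spaces.linear sXA sU (V_id y)"
proof -
  have "bilinear_map sX sA sU (\<lambda>x b. tL (cover_l1 tXA \<alpha> y x) b)"
    by (rule XA.bilinear_mapI)
      (auto intro: L.vT.vector_space_axioms simp: L.tens_bilinear bilinear_mapD[OF bilinear_covers_\<alpha>(2)])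
  then show "V_id y (tXA x b) = tL (cover_l1 tXA \<alpha> y x) b" "Vector_Spaces.linear sXA sU (V_id y)"
    unfolding V_id_def by (rule XA.tensor_lift_tens XA.linear_tensor_lift)+
qed

lemma
  shows id_T_tens: "id_T a (tXA x b) = tR x (cover_r2 tAA \<Delta> b a)"
    and linear_id_T: "Vector_Spaces.linear sXA sU (id_T a)"
proof -
  have "bilinear_map sX sA sU (\<lambda>x b. tR x (cover_r2 tAA \<Delta> b a))"
    by (rule XA.bilinear_mapI)
      (auto intro: L.vT.vector_space_axioms simp: R.tens_bilinear bilinear_mapD[OF bilinear_covers_\<Delta>(1)])
  then show "id_T a (tXA x b) = tR x (cover_r2 tAA \<Delta> b a)" "Vector_Spaces.linear sXA sU (id_T a)"
    unfolding id_T_def by (rule XA.tensor_lift_tens XA.linear_tensor_lift)+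
qed

lemma
  shows id_T'_tens: "id_T' a (tXA x b) = tR x (cover_l2 tAA \<Delta> a b)"
    and linear_id_T': "Vector_Spaces.linear sXA sU (id_T' a)"
proof -
  have "bilinear_map sX sA sU (\<lambda>x b. tR x (cover_l2 tAA \<Delta> a b))"
    by (rule XA.bilinear_mapI)
      (auto intro: L.vT.vector_space_axioms simp: R.tens_bilinear bilinear_mapD[OF bilinear_covers_\<Delta>(2)])
  then show "id_T' a (tXA x b) = tR x (cover_l2 tAA \<Delta> a b)" "Vector_Spaces.linear sXA sU (id_T' a)"
    unfolding id_T'_def by (rule XA.tensor_lift_tens XA.linear_tensor_lift)+
qed

lemmas V_id_add = linearD(1)[OF linear_V_id]
lemmas id_T_add = linearD(1)[OF linear_id_T]
lemmas id_T'_add = linearD(1)[OF linear_id_T']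

lemma L_ml: "mtens tL (XA.ml y) 1 = mtens tR (emb y) 1"
  by (simp add: mtens_assoc)

lemma L_mr: "L.mr a = mtens tR 1 (AB.mr a)"
  using mtens_assoc[of 1 1 "emb a"] by simp

lemma emb_V_id: "emb (V_id y t) = mtens tR (emb y) 1 * \<alpha>\<iota> t"
proof (induction t rule: XA.tensor_induct)
  case (tens x b)
  show ?case
    by (simp add: V_id_tens \<alpha>\<iota>_tens L.mtens_emb[symmetric] emb_cover_\<alpha> L_ml[symmetric] L.mtens_mult)
qed (simp add: V_id_add emb_add \<alpha>\<iota>_add distrib_left)

lemma emb_id_T: "emb (id_T a t) = \<iota>\<Delta> t * L.mr a"
proof (induction t rule: XA.tensor_induct)
  case (tens x b)
  show ?case
    by (simp add: id_T_tens \<iota>\<Delta>_tens R.mtens_emb[symmetric] emb_cover_\<Delta> L_mr R.mtens_mult)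
qed (simp add: id_T_add emb_add \<iota>\<Delta>_add distrib_right)

text \<open>
  Two ways of computing \<open>(y \<otimes> 1 \<otimes> 1) n (1 \<otimes> 1 \<otimes> a)\<close> for the multiplier \<open>n = (\<alpha> \<otimes> \<iota>)\<alpha>(x) =
  (\<iota> \<otimes> \<Delta>)\<alpha>(x)\<close>: by reading the product with \<open>1 \<otimes> 1 \<otimes> a\<close> in the first form, or the product with
  \<open>y \<otimes> 1 \<otimes> 1\<close> in the second.
\<close>

lemma V_id_cover_r2: "V_id y (cover_r2 tXA \<alpha> x a) = id_T a (cover_l1 tXA \<alpha> y x)"
proof -
  have "emb (V_id y (cover_r2 tXA \<alpha> x a)) = mtens tR (emb y) 1 * (mult_ext \<iota>\<Delta> (\<alpha> x) * L.mr a)"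
    by (simp only: emb_V_id coassociative_mult(1))
  also have "\<dots> = emb (id_T a (cover_l1 tXA \<alpha> y x))"
    by (simp only: mult.assoc[symmetric] ml_mult_ext emb_id_T)
  finally show ?thesis by simp
qed

lemma app_mr_V_id:
  "app_l (L.mr b) (V_id y t) = V_id y (app_l (XA.mr b) t)"
  "app_r (L.mr b) (V_id y t) = V_id y (app_r (XA.mr b) t)"
  by (induction t rule: XA.tensor_induct; simp add: V_id_tens V_id_add app_l_add app_r_add)+

lemma app_mr_id_T': "app_r (L.mr b) (id_T' a t) = app_l (L.mr a) (id_T b t)"
proof -
  have "app_r (AB.mr b) (cover_l2 tAA \<Delta> a c) = app_l (AB.mr a) (cover_r2 tAA \<Delta> c b)" for c
    by (simp flip: AB.T.emb_eq_iff mult_emb emb_mult_left add: emb_cover_\<Delta> mult.assoc)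
  then show ?thesis
    by (induction t rule: XA.tensor_induct)
      (simp_all add: L_mr id_T_tens id_T'_tens id_T_add id_T'_add app_l_add app_r_add)
qed

text \<open>
  The version with \<open>1 \<otimes> a\<close> on the left reduces to the one with \<open>1 \<otimes> b\<close> on the right by multiplying both
  sides with \<open>1 \<otimes> 1 \<otimes> b\<close> from the right, which can be cancelled.
\<close>

lemma V_id_cover_l2: "V_id y (cover_l2 tXA \<alpha> a x) = id_T' a (cover_l1 tXA \<alpha> y x)"
proof (rule L.cancel_mr)
  show "app_r (L.mr b) (V_id y (cover_l2 tXA \<alpha> a x)) = app_r (L.mr b) (id_T' a (cover_l1 tXA \<alpha> y x))"
    for b
    by (simp only: app_mr_id_T' app_mr_V_id mr_cover_r2[symmetric] V_id_cover_r2[symmetric])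
qed

text \<open>
  Coassociativity with \<open>\<iota> \<otimes> \<iota> \<otimes> \<theta>\<close> applied to both sides: in Sweedler notation both are
  \<open>y x\<^sub>0 \<otimes> x\<^sub>1 \<theta>(x\<^sub>2 a)\<close>, respectively \<open>y x\<^sub>0 \<otimes> x\<^sub>1 \<theta>(a x\<^sub>2)\<close>. This is what gives access to the
  coaction on elements of the form \<open>x\<^sub>0 \<theta>(x\<^sub>1 a)\<close> and \<open>x\<^sub>0 \<theta>(a x\<^sub>1)\<close>.
\<close>

lemma slice_coassociative_r2:
  assumes \<theta>: "Vector_Spaces.linear sA (*) \<theta>"
  shows "cover_l1 tXA \<alpha> y (XA.sr \<theta> (cover_r2 tXA \<alpha> x a))
    = XA.map_right (\<lambda>b. AB.sr \<theta> (cover_r2 tAA \<Delta> b a)) (cover_l1 tXA \<alpha> y x)"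
proof -
  have lin: "Vector_Spaces.linear sA sA (\<lambda>b. AB.sr \<theta> (cover_r2 tAA \<Delta> b a))"
    by (rule linear_compose_apply[OF bilinear_mapD_linear(1)[OF bilinear_covers_\<Delta>(1)] AB.linear_sr[OF \<theta>]])
  have l: "L.sr \<theta> (V_id y t) = cover_l1 tXA \<alpha> y (XA.sr \<theta> t)" for t
    by (induction t rule: XA.tensor_induct)
      (simp_all add: V_id_tens V_id_add \<theta> L.sr_add[OF \<theta>] XA.sr_add[OF \<theta>]
        bilinear_mapD[OF bilinear_covers_\<alpha>(2)])
  have r: "L.sr \<theta> (id_T a t) = XA.map_right (\<lambda>b. AB.sr \<theta> (cover_r2 tAA \<Delta> b a)) t" for t
    by (induction t rule: XA.tensor_induct)
      (simp_all add: id_T_tens id_T_add \<theta> L.sr_add[OF \<theta>] L_sr_tR[OF \<theta>]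
        XA.map_right_tens[OF lin] XA.map_right_add[OF lin])
  show ?thesis unfolding l[symmetric] r[symmetric] V_id_cover_r2 ..
qed

lemma slice_coassociative_l2:
  assumes \<theta>: "Vector_Spaces.linear sA (*) \<theta>"
  shows "cover_l1 tXA \<alpha> y (XA.sr \<theta> (cover_l2 tXA \<alpha> a x))
    = XA.map_right (\<lambda>b. AB.sr \<theta> (cover_l2 tAA \<Delta> a b)) (cover_l1 tXA \<alpha> y x)"
proof -
  have lin: "Vector_Spaces.linear sA sA (\<lambda>b. AB.sr \<theta> (cover_l2 tAA \<Delta> a b))"
    by (rule linear_compose_apply[OF bilinear_mapD_linear(2)[OF bilinear_covers_\<Delta>(2)] AB.linear_sr[OF \<theta>]])
  have l: "L.sr \<theta> (V_id y t) = cover_l1 tXA \<alpha> y (XA.sr \<theta> t)" for t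
    by (induction t rule: XA.tensor_induct)
      (simp_all add: V_id_tens V_id_add \<theta> L.sr_add[OF \<theta>] XA.sr_add[OF \<theta>]
        bilinear_mapD[OF bilinear_covers_\<alpha>(2)])
  have r: "L.sr \<theta> (id_T' a t) = XA.map_right (\<lambda>b. AB.sr \<theta> (cover_l2 tAA \<Delta> a b)) t" for t
    by (induction t rule: XA.tensor_induct)
      (simp_all add: id_T'_tens id_T'_add \<theta> L.sr_add[OF \<theta>] L_sr_tR[OF \<theta>]
        XA.map_right_tens[OF lin] XA.map_right_add[OF lin])
  show ?thesis unfolding l[symmetric] r[symmetric] V_id_cover_l2 ..
qed

text \<open>
  In Sweedler notation, \<open>\<chi>(x) = \<omega>(y x\<^sub>0) \<psi>(x\<^sub>1)\<close> and hence \<open>\<chi>(x\<^sub>0) x\<^sub>1 = \<omega>(y x\<^sub>0) \<psi>(x\<^sub>1) x\<^sub>2\<close>, where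
  \<open>\<psi>(x\<^sub>1) x\<^sub>2\<close> is \<open>\<psi>(x\<^sub>1) 1\<close>. This is \<open>V_id_cover_r2\<close> with \<open>\<omega> \<otimes> \<psi> \<otimes> \<iota>\<close> applied to both sides.
\<close>

lemma invariant_on_X:
  fixes y :: 'x and \<psi> :: "'a \<Rightarrow> 'k"
  assumes \<psi>: "Vector_Spaces.linear sA (*) \<psi>" and \<omega>: "Vector_Spaces.linear sX (*) \<omega>"
    and inv: "\<And>a b. AB.sl \<psi> (cover_r2 tAA \<Delta> a b) = sA (\<psi> a) b"
  defines "\<chi> \<equiv> \<lambda>x. \<psi> (XA.sl \<omega> (cover_l1 tXA \<alpha> y x))"
  shows "Vector_Spaces.linear sX (*) \<chi>" "XA.sl \<chi> (cover_r2 tXA \<alpha> x a) = sA (\<chi> x) a"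
proof -
  show \<chi>: "Vector_Spaces.linear sX (*) \<chi>" unfolding \<chi>_def
    by (intro linear_compose_apply[OF linear_compose_apply[OF
      bilinear_mapD_linear(2)[OF bilinear_covers_\<alpha>(2)] XA.linear_sl[OF \<omega>]] \<psi>])
  have c: "\<psi> (XA.sl \<omega> (cover_l1 tXA \<alpha> y x)) = \<chi> x" for x by (simp add: \<chi>_def)
  have l: "AB.sl \<psi> (R.sl \<omega> (V_id y t)) = XA.sl \<chi> t" for t
    by (induction t rule: XA.tensor_induct)
      (simp_all add: V_id_tens V_id_add \<psi> \<chi> R_sl_tL[OF \<omega>] R.sl_add[OF \<omega>] AB.sl_add[OF \<psi>] XA.sl_add[OF \<chi>]
        c)
  have r: "AB.sl \<psi> (R.sl \<omega> (id_T a t)) = sA (\<psi> (XA.sl \<omega> t)) a" for t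
    by (induction t rule: XA.tensor_induct)
      (simp_all add: id_T_tens id_T_add \<psi> \<omega> R.sl_add[OF \<omega>] AB.sl_add[OF \<psi>] AB.sl_scale[OF \<psi>] inv
        XA.sl_add[OF \<omega>] linearD[OF \<psi>] XA.vB.scale_left_distrib)
  show "XA.sl \<chi> (cover_r2 tXA \<alpha> x a) = sA (\<chi> x) a"
    unfolding l[symmetric] V_id_cover_r2 r c ..
qed

end

section \<open>Counit, antipode and right invariant functionals\<close>

context regular_multiplier_hopf_algebra
begin

sublocale nondegenerate_triple_tensor sA sA sA sAA tAA sAA tAA sAAA tL tR
  by unfold_locales

abbreviation "D1 \<equiv> cover_r2 tAA \<Delta>"
abbreviation "D2 \<equiv> cover_l1 tAA \<Delta>"
abbreviation "D3 \<equiv> cover_r1 tAA \<Delta>"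
abbreviation "D4 \<equiv> cover_l2 tAA \<Delta>"
abbreviation "ml \<equiv> XA.ml"
abbreviation "mr \<equiv> XA.mr"
abbreviation "sl \<equiv> XA.sl"
abbreviation "sr \<equiv> XA.sr"

lemma lin_\<Delta>: "Vector_Spaces.linear sA (mscale sAA) \<Delta>" and mult_\<Delta>: "\<Delta> (a * b) = \<Delta> a * \<Delta> b"
  using hom by (auto simp: algebra_hom_def)

lemmas bijD1 = XA.bijective_onto_tensorD[OF XA.T.k_algebra_axioms XA.bilinear_multiplier_products(1)[OF lin_\<Delta>] bij1]
lemmas bijD2 = XA.bijective_onto_tensorD[OF XA.T.k_algebra_axioms XA.bilinear_multiplier_products(2)[OF lin_\<Delta>] bij2]
lemmas bijD3 = XA.bijective_onto_tensorD[OF XA.T.k_algebra_axioms XA.bilinear_multiplier_products(3)[OF lin_\<Delta>] bij3]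
lemmas bijD4 = XA.bijective_onto_tensorD[OF XA.T.k_algebra_axioms XA.bilinear_multiplier_products(4)[OF lin_\<Delta>] bij4]

lemma emb_D:
  shows "emb (D1 a b) = \<Delta> a * mr b" "emb (D2 a b) = ml a * \<Delta> b"
    and "emb (D3 a b) = \<Delta> a * ml b" "emb (D4 a b) = mr a * \<Delta> b"
  by (simp_all add: cover_r2_def cover_l1_def cover_r1_def cover_l2_def emb_inv_emb bijD1 bijD2 bijD3 bijD4)

lemma bilinear_D:
  shows "bilinear_map sA sA sAA D1" "bilinear_map sA sA sAA D2"
    and "bilinear_map sA sA sAA D3" "bilinear_map sA sA sAA D4"
  using bijD1(2) bijD2(2) bijD3(2) bijD4(2)
  by (simp_all add: cover_r2_def[abs_def] cover_l1_def[abs_def] cover_r1_def[abs_def] cover_l2_def[abs_def])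

text \<open>
  The four canonical maps; they are bijections of \<open>A \<otimes> A\<close>, and most identities below are checked on the
  image of one of them.
\<close>

definition "T1 = tensor_lift sAA tAA sAA D1"
definition "T2 = tensor_lift sAA tAA sAA D2"
definition "T3 = tensor_lift sAA tAA sAA D3"
definition "T4 = tensor_lift sAA tAA sAA D4"

lemma T_tens [simp]:
  "T1 (tAA a b) = D1 a b" "T2 (tAA a b) = D2 a b" "T3 (tAA a b) = D3 a b" "T4 (tAA a b) = D4 a b"
  unfolding T1_def T2_def T3_def T4_def by (rule XA.tensor_lift_tens, rule bilinear_D)+

lemma linear_T:
  "Vector_Spaces.linear sAA sAA T1" "Vector_Spaces.linear sAA sAA T2"
  "Vector_Spaces.linear sAA sAA T3" "Vector_Spaces.linear sAA sAA T4"
  unfolding T1_def T2_def T3_def T4_def by (rule XA.linear_tensor_lift, rule bilinear_D)+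

lemma bij_T: "bij T1" "bij T2" "bij T3" "bij T4"
  using bijD1(3) bijD2(3) bijD3(3) bijD4(3)
  by (simp_all add: T1_def T2_def T3_def T4_def cover_r2_def[abs_def] cover_l1_def[abs_def]
    cover_r1_def[abs_def] cover_l2_def[abs_def])

text \<open>
  If \<open>g\<close> kills all products, then \<open>\<iota> \<otimes> g\<close> kills \<open>\<Delta>(a) (b \<otimes> c) = (\<Delta>(a) (b \<otimes> 1)) (1 \<otimes> c)\<close>, because
  \<open>\<Delta>(a) (b \<otimes> 1)\<close> lies in \<open>A \<otimes> A\<close>. These elements span \<open>A \<otimes> A\<close>.
\<close>

lemma idempotent: "idempotent_algebra sA"
proof (rule idempotent_algebraI)
  fix g x assume g: "Vector_Spaces.linear sA (*) g" and 0: "\<And>a b. g (a * b) = 0"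
  obtain p :: 'a where p: "p \<noteq> 0" using nonzero by blast
  obtain f where f: "Vector_Spaces.linear sA (*) f" "f p = 1"
    using separating_functional[of p "{}"] p by auto
  have lin: "Vector_Spaces.linear sAA (*) (\<lambda>z. f (sr g z))"
    by (rule linear_compose_apply[OF XA.linear_sr[OF g] f(1)])
  have 1: "sr g (app_r (mr c) w) = 0" for c w
    by (induction w rule: XA.tensor_induct) (simp_all add: g 0 app_r_add XA.sr_add[OF g])
  have "app_l (\<Delta> a) (tAA b c) = app_r (mr c) (D3 a b)" for a b c
  proof -
    have "emb (app_l (\<Delta> a) (tAA b c)) = \<Delta> a * ml b * mr c"
      by (simp add: mult_emb[symmetric] XA.mtens_emb[symmetric] XA.mtens_mult mult.assoc)
    then show ?thesis by (simp add: emb_D(3)[symmetric] emb_mult_left)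
  qed
  then have 2: "sr g (app_l (\<Delta> a) z) = 0" for a z
    by (induction z rule: XA.tensor_induct) (simp_all add: 1 app_l_add XA.sr_add[OF g])
  have "f (sr g (tAA p x)) = 0"
    by (rule XA.vT.functional_vanishes_if_span_eq_UNIV[OF nondeg_l lin])
      (use 2 linearD(3)[OF f(1)] in auto)
  then show "g x = 0" using f(2) by (simp add: g linearD[OF f(1)])
qed

sublocale reduced_coaction sA sA sAA tAA sAA tAA sAAA tL tR \<Delta> \<Delta>
  by unfold_locales
    (use hom coassoc nondeg_l nondeg_r bijD1(1) bijD2(1) bijD4(1) idempotent in auto)

lemmas D_bilinear = bilinear_mapD[OF bilinear_D(1)] bilinear_mapD[OF bilinear_D(2)]
  bilinear_mapD[OF bilinear_D(3)] bilinear_mapD[OF bilinear_D(4)]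
lemmas T_add = linear_T[THEN linearD(1)]

lemma
  shows T1_induct: "(\<And>t. P (T1 t)) \<Longrightarrow> P z" and T2_induct: "(\<And>t. P (T2 t)) \<Longrightarrow> P z"
    and T3_induct: "(\<And>t. P (T3 t)) \<Longrightarrow> P z" and T4_induct: "(\<And>t. P (T4 t)) \<Longrightarrow> P z"
  using bij_T[THEN bij_is_surj] by (metis surjD)+

lemma ml_D1: "app_l (ml p) (D1 a b) = app_r (mr b) (D2 p a)"
  by (simp flip: XA.T.emb_eq_iff mult_emb emb_mult_left add: emb_D mult.assoc)

lemma ml_D3: "app_l (ml p) (D3 a b) = app_r (ml b) (D2 p a)"
  by (simp flip: XA.T.emb_eq_iff mult_emb emb_mult_left add: emb_D mult.assoc)

lemma \<Delta>_D3: "app_l (\<Delta> a) (D3 b c) = D3 (a * b) c"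
  by (simp flip: XA.T.emb_eq_iff mult_emb emb_mult_left add: emb_D mult.assoc mult_\<Delta>)

lemma D2_\<Delta>: "app_r (\<Delta> a) (D2 c b) = D2 c (b * a)"
  by (simp flip: XA.T.emb_eq_iff mult_emb emb_mult_left add: emb_D mult.assoc mult_\<Delta>)

lemma \<Delta>_tens: "app_l (\<Delta> a) (tAA c b) = app_r (ml c) (D1 a b)"
proof -
  have "emb (app_l (\<Delta> a) (tAA c b)) = \<Delta> a * mr b * ml c"
    by (simp add: mult_emb[symmetric] XA.mtens_emb[symmetric] XA.mtens_mult mult.assoc)
  then show ?thesis by (simp add: emb_D(1)[symmetric] emb_mult_left)
qed

lemma tens_\<Delta>: "app_r (\<Delta> b) (tAA p a) = app_l (ml p) (D4 a b)"
proof -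
  have "emb (app_r (\<Delta> b) (tAA p a)) = ml p * mr a * \<Delta> b"
    by (simp add: emb_mult_left[symmetric] XA.mtens_emb[symmetric] XA.mtens_mult)
  then show ?thesis by (simp add: mult.assoc emb_D(4)[symmetric] mult_emb)
qed

text \<open>
  The map \<open>E\<close> sending \<open>\<Delta>(a) (1 \<otimes> b)\<close> to \<open>a b\<close> should be \<open>\<epsilon> \<otimes> \<iota>\<close>, and the map \<open>E'\<close> sending
  \<open>(a \<otimes> 1) \<Delta>(b)\<close> to \<open>a b\<close> should be \<open>\<iota> \<otimes> \<epsilon>\<close>. Applying \<open>\<iota> \<otimes> E\<close> to coassociativity yields
  \<open>p \<otimes> E(x \<otimes> c) = E'(p \<otimes> x) \<otimes> c\<close>. Comparing the two sides for a fixed \<open>p \<noteq> 0\<close> shows that \<open>E(x \<otimes> c)\<close>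
  is a multiple of \<open>c\<close>, and the factor is \<open>\<epsilon>(x)\<close>.
\<close>

lemma counit:
  obtains \<epsilon> where "Vector_Spaces.linear sA (*) \<epsilon>" "\<And>a b. sl \<epsilon> (D1 a b) = a * b"
proof -
  define m where "m = tensor_lift sAA tAA sA (*)"
  have bil: "bilinear_map sA sA sA (*)"
    by (rule XA.bilinear_mapI)
      (auto simp: distrib_left distrib_right scale_mult_left[symmetric] scale_mult_right[symmetric]
        intro: vector_space_axioms)
  have m_tens: "m (tAA a b) = a * b" for a b unfolding m_def by (rule XA.tensor_lift_tens[OF bil])
  have lin_m: "Vector_Spaces.linear sAA sA m" unfolding m_def by (rule XA.linear_tensor_lift[OF bil])
  define E where "E z = m (inv T1 z)" for z
  have lin_E: "Vector_Spaces.linear sAA sA E"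
    unfolding E_def by (rule linear_compose_apply[OF linear_inv[OF linear_T(1) bij_T(1)] lin_m])
  have E_D1: "E (D1 a b) = a * b" for a b
    using bij_is_inj[OF bij_T(1)] by (simp add: E_def m_tens inv_f_f flip: T_tens(1))
  define IE where "IE = tensor_lift sAAA tR sAA (\<lambda>x w. tAA x (E w))"
  have bilIE: "bilinear_map sA sAA sAA (\<lambda>x w. tAA x (E w))"
    by (rule R.bilinear_mapI)
      (auto simp: XA.tens_bilinear linearD[OF lin_E] intro: XA.vT.vector_space_axioms)
  have IE_tens: "IE (tR x w) = tAA x (E w)" for x w
    unfolding IE_def by (rule R.tensor_lift_tens[OF bilIE])
  have lin_IE: "Vector_Spaces.linear sAAA sAA IE"
    unfolding IE_def by (rule R.linear_tensor_lift[OF bilIE])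
  have 1: "IE (id_T c t) = app_r (mr c) t" for c t
    by (induction t rule: XA.tensor_induct)
      (simp_all add: id_T_tens id_T_add IE_tens linearD[OF lin_IE] app_r_add E_D1)
  have "IE (V_id a (T1 t)) = app_l (ml a) (T1 t)" for a t
    by (induction t rule: XA.tensor_induct)
      (simp_all add: V_id_cover_r2 1 ml_D1 T_add V_id_add linearD[OF lin_IE] app_l_add)
  then have 2: "IE (V_id a z) = app_l (ml a) z" for a z
    by (induction z rule: T1_induct)
  \<comment> \<open>With \<open>t\<close> the preimage of \<open>p \<otimes> x\<close> under \<open>T2\<close>, the value \<open>m t\<close> is \<open>E'(p \<otimes> x)\<close>.\<close>
  have 3: "IE (tL (T2 t) c) = tAA (m t) c" for t c
  proof (induction t rule: XA.tensor_induct)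
    case (tens a x)
    show ?case using 2[of a "tAA x c"] by (simp add: V_id_tens m_tens)
  qed (simp add: T_add L.tens_add_left linearD[OF lin_IE] linearD[OF lin_m] XA.tens_add_left)
  obtain p :: 'a where p: "p \<noteq> 0" using nonzero by blast
  obtain f where f: "Vector_Spaces.linear sA (*) f" "f p = 1"
    using separating_functional[of p "{}"] p by auto
  define \<epsilon> where "\<epsilon> x = f (m (inv T2 (tAA p x)))" for x
  have "Vector_Spaces.linear sA sAA (tAA p)"
    using vector_space_axioms XA.vT.vector_space_axioms
    by (simp add: Vector_Spaces.linear_iff XA.tens_bilinear)
  then have \<epsilon>: "Vector_Spaces.linear sA (*) \<epsilon>" unfolding \<epsilon>_def
    by (rule linear_compose_apply[OF linear_compose_apply[OF linear_compose_apply[OF _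
      linear_inv[OF linear_T(2) bij_T(2)]] lin_m] f(1)])
  have "E (tAA x c) = sA (\<epsilon> x) c" for x c
  proof -
    have "T2 (inv T2 (tAA p x)) = tAA p x" by (rule surj_f_inv_f[OF bij_is_surj[OF bij_T(2)]])
    then have "tAA p (E (tAA x c)) = tAA (m (inv T2 (tAA p x))) c"
      using 3[of "inv T2 (tAA p x)" c] by (simp add: assoc IE_tens)
    then show ?thesis
      using XA.sl_tens[OF f(1), of p "E (tAA x c)"] XA.sl_tens[OF f(1), of "m (inv T2 (tAA p x))" c] f(2)
      by (simp add: \<epsilon>_def)
  qed
  then have "sl \<epsilon> z = E z" for z
    by (induction z rule: XA.tensor_induct) (simp_all add: \<epsilon> XA.sl_add[OF \<epsilon>] linearD[OF lin_E])
  then show ?thesis using that[OF \<epsilon>] E_D1 by simp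
qed

text \<open>
  Both conditions say \<open>(\<iota> \<otimes> g)\<Delta>(c) = g(c) 1\<close>, tested by multiplication with elements of \<open>A\<close> from the
  left or from the right; the two tests are compared on \<open>(p \<otimes> 1) \<Delta>(c) (s \<otimes> 1)\<close>.
\<close>

lemma invariance_D2_iff_D3:
  assumes g: "Vector_Spaces.linear sA (*) g"
  shows "(\<forall>p c. sr g (D2 p c) = sA (g c) p) \<longleftrightarrow> (\<forall>c s. sr g (D3 c s) = sA (g c) s)"
proof -
  have *: "p * sr g (D3 c s) = sr g (D2 p c) * s" for p c s
    using arg_cong[OF ml_D3[of p c s], of "sr g"] by (simp add: XA.sr_app_ml[OF g])
  show ?thesis
  proof (intro iffI allI)
    fix c s assume "\<forall>p c. sr g (D2 p c) = sA (g c) p"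
    then have "p * (sr g (D3 c s) - sA (g c) s) = 0" for p
      using *[of p c s] by (simp add: right_diff_distrib scale_mult_left[symmetric] scale_mult_right[symmetric])
    then show "sr g (D3 c s) = sA (g c) s" using nondegenerate_right[of "sr g (D3 c s) - sA (g c) s"] by simp
  next
    fix p c assume "\<forall>c s. sr g (D3 c s) = sA (g c) s"
    then have "(sr g (D2 p c) - sA (g c) p) * s = 0" for s
      using *[of p c s] by (simp add: left_diff_distrib scale_mult_left[symmetric] scale_mult_right[symmetric])
    then show "sr g (D2 p c) = sA (g c) p" using nondegenerate_left[of "sr g (D2 p c) - sA (g c) p"] by simp
  qed
qed

context
  fixes \<phi> assumes \<phi>: "Vector_Spaces.linear sA (*) \<phi>" and \<phi>_nonzero: "\<exists>a. \<phi> a \<noteq> 0"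
    and \<phi>_invariant: "\<And>a b. sr \<phi> (D3 a b) = sA (\<phi> a) b"
begin

lemma \<phi>_invariant_D2: "sr \<phi> (D2 b a) = sA (\<phi> a) b"
  using invariance_D2_iff_D3[OF \<phi>] \<phi>_invariant by blast

text \<open>
  In Sweedler notation, \<open>slice_r2 a b = a\<^sub>1 \<phi>(a\<^sub>2 b)\<close> and \<open>slice_l2 a b = b\<^sub>1 \<phi>(a b\<^sub>2)\<close>. The antipode maps
  the first to the second.
\<close>

definition "slice_r2 a b = sr \<phi> (D1 a b)"
definition "slice_l2 a b = sr \<phi> (D4 a b)"

lemma slice_r2_add: "slice_r2 (a + a') b = slice_r2 a b + slice_r2 a' b" "slice_r2 a (b + b') = slice_r2 a b + slice_r2 a b'"
  by (simp_all add: slice_r2_def D_bilinear XA.sr_add[OF \<phi>])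

lemma linear_slice_r2: "Vector_Spaces.linear sA sA (\<lambda>a. slice_r2 a b)" "Vector_Spaces.linear sA sA (slice_r2 a)"
  unfolding slice_r2_def
  by (rule linear_compose_apply[OF bilinear_mapD_linear(1)[OF bilinear_D(1)] XA.linear_sr[OF \<phi>]]
    linear_compose_apply[OF bilinear_mapD_linear(2)[OF bilinear_D(1)] XA.linear_sr[OF \<phi>]])+

lemma linear_slice_l2: "Vector_Spaces.linear sA sA (slice_l2 a)"
  unfolding slice_l2_def
  by (rule linear_compose_apply[OF bilinear_mapD_linear(2)[OF bilinear_D(4)] XA.linear_sr[OF \<phi>]])

lemma D2_slice_r2: "D2 p (slice_r2 a b) = XA.map_right (\<lambda>v. slice_r2 v b) (D2 p a)"
  unfolding slice_r2_def by (rule slice_coassociative_r2[OF \<phi>])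

lemma D2_slice_l2: "D2 p (slice_l2 a b) = XA.map_right (slice_l2 a) (D2 p b)"
  unfolding slice_l2_def[abs_def] by (rule slice_coassociative_l2[OF \<phi>])

text \<open>
  The slices span \<open>A\<close>, since \<open>\<phi>\<close> is non-zero and the \<open>\<Delta>(a) (1 \<otimes> b)\<close> span \<open>A \<otimes> A\<close>.
\<close>

lemma slice_r2_induct [case_names slice add]:
  assumes slices: "\<And>a b. P (slice_r2 a b)" and add: "\<And>c d. P c \<Longrightarrow> P d \<Longrightarrow> P (c + d)"
  shows "P c"
proof -
  have *: "P (sr \<phi> (T1 t))" for t
    by (induction t rule: XA.tensor_induct) (simp_all add: slices[unfolded slice_r2_def] T_add XA.sr_add[OF \<phi>] add)
  obtain b where b: "\<phi> b \<noteq> 0" using \<phi>_nonzero by blast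
  obtain t where "tAA c (sA (1 / \<phi> b) b) = T1 t"
    using bij_is_surj[OF bij_T(1)] by (metis surjD)
  then have "sr \<phi> (T1 t) = c"
    using b XA.sr_tens[OF \<phi>, of c "sA (1 / \<phi> b) b"] by (simp add: linearD[OF \<phi>])
  then show ?thesis using *[of t] by simp
qed

text \<open>
  Let \<open>N\<close> be the map that sends \<open>(q \<otimes> 1) \<Delta>(a)\<close> to \<open>\<epsilon>(a) q\<close>; it stands for \<open>p \<otimes> c \<mapsto> p S(c)\<close>. By left
  invariance \<open>\<iota> \<otimes> \<phi>\<close> sends \<open>(q \<otimes> 1) \<Delta>(a) \<Delta>(b)\<close> to \<open>\<phi>(a b) q\<close>, and
  \<open>\<phi>(a b) = \<epsilon>(c)\<close> for \<open>c = a\<^sub>1 \<phi>(a\<^sub>2 b)\<close>, while coassociativity identifies \<open>(q \<otimes> 1) \<Delta>(c)\<close> with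
  \<open>(\<iota> \<otimes> (a \<mapsto> a\<^sub>1 \<phi>(a\<^sub>2 b)))((q \<otimes> 1) \<Delta>(a))\<close>. So \<open>(\<iota> \<otimes> \<phi>)(z \<Delta>(b))\<close> is the value of \<open>N\<close> at
  \<open>(\<iota> \<otimes> (a \<mapsto> a\<^sub>1 \<phi>(a\<^sub>2 b)))(z)\<close> for all \<open>z = (q \<otimes> 1) \<Delta>(a)\<close>, hence for all \<open>z\<close>. For \<open>z = p \<otimes> a\<close> this
  reads \<open>p (b\<^sub>1 \<phi>(a b\<^sub>2)) = N(p \<otimes> a\<^sub>1 \<phi>(a\<^sub>2 b))\<close>, and \<open>S\<close> is obtained by cancelling \<open>p\<close>.
\<close>

lemma antipode:
  obtains S where "Vector_Spaces.linear sA sA S" "\<And>a b. S (slice_r2 a b) = slice_l2 a b"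
proof -
  obtain \<epsilon> where \<epsilon>: "Vector_Spaces.linear sA (*) \<epsilon>" and \<epsilon>_D1: "\<And>a b. sl \<epsilon> (D1 a b) = a * b"
    using counit by blast
  have \<epsilon>_F: "\<epsilon> (slice_r2 a b) = \<phi> (a * b)" for a b
    unfolding slice_r2_def by (simp add: XA.functional_slices[OF \<epsilon> \<phi>] \<epsilon>_D1)
  define N where "N z = sr \<epsilon> (inv T2 z)" for z
  have lin_N: "Vector_Spaces.linear sAA sA N"
    unfolding N_def by (rule linear_compose_apply[OF linear_inv[OF linear_T(2) bij_T(2)] XA.linear_sr[OF \<epsilon>]])
  have N_D2: "N (D2 q c) = sA (\<epsilon> c) q" for q c
    using bij_is_inj[OF bij_T(2)] by (simp add: N_def \<epsilon> inv_f_f flip: T_tens(2))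
  have "sr \<phi> (app_r (\<Delta> b) (T2 t)) = N (XA.map_right (\<lambda>a. slice_r2 a b) (T2 t))" for b t
  proof (induction t rule: XA.tensor_induct)
    case (tens q a)
    show ?case by (simp add: D2_\<Delta> \<phi>_invariant_D2 D2_slice_r2[symmetric] N_D2 \<epsilon>_F)
  qed (simp add: T_add app_r_add XA.sr_add[OF \<phi>] XA.map_right_add[OF linear_slice_r2(1)] linearD[OF lin_N])
  then have "sr \<phi> (app_r (\<Delta> b) z) = N (XA.map_right (\<lambda>a. slice_r2 a b) z)" for b z
    by (induction z rule: T2_induct)
  from this[of _ "tAA _ _"] have N_F: "N (tAA p (slice_r2 a b)) = p * slice_l2 a b" for p a b
    by (simp add: tens_\<Delta> XA.sr_app_ml[OF \<phi>] slice_l2_def XA.map_right_tens[OF linear_slice_r2(1)])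
  have "\<exists>s. \<forall>p. p * s = N (tAA p c)" for c
  proof (induction c rule: slice_r2_induct)
    case (slice a b)
    show ?case by (rule exI[of _ "slice_l2 a b"]) (simp add: N_F)
  next
    case (add c d)
    then obtain s t where "\<And>p. p * s = N (tAA p c)" "\<And>p. p * t = N (tAA p d)" by blast
    then show ?case
      by (intro exI[of _ "s + t"]) (simp add: XA.tens_add_right distrib_left linearD(1)[OF lin_N])
  qed
  then obtain S where S: "p * S c = N (tAA p c)" for p c by metis
  have eqI: "s = s'" if "\<And>p. p * s = p * s'" for s s' :: 'a
    using nondegenerate_right[of "s - s'"] that by (simp add: right_diff_distrib)
  have "S (c + d) = S c + S d" for c d
    by (rule eqI) (simp add: S distrib_left XA.tens_add_right linearD[OF lin_N])
  moreover have "S (sA k c) = sA k (S c)" for k c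
    by (rule eqI) (simp add: S XA.tens_scale_right linearD[OF lin_N] flip: scale_mult_right)
  ultimately have "Vector_Spaces.linear sA sA S"
    using vector_space_axioms by (simp add: Vector_Spaces.linear_iff)
  moreover have "S (slice_r2 a b) = slice_l2 a b" for a b
    by (rule eqI) (simp add: S N_F)
  ultimately show ?thesis using that by blast
qed

lemma slice_r2_mult: "slice_r2 v b * q = sr \<phi> (app_l (\<Delta> v) (tAA q b))"
  by (simp add: slice_r2_def \<Delta>_tens XA.sr_app_ml[OF \<phi>])

text \<open>
  \<open>K a\<close> is the map \<open>q \<otimes> b \<mapsto> \<Delta>(a\<^sub>1 \<phi>(a\<^sub>2 b)) (1 \<otimes> q) = a\<^sub>1 \<otimes> a\<^sub>2 q \<phi>(a\<^sub>3 b)\<close>. Its value at an element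
  \<open>z\<close> of \<open>A \<otimes> A\<close> is \<open>a\<^sub>1 \<otimes> (\<iota> \<otimes> \<phi>)(\<Delta>(a\<^sub>2) z)\<close>, which for \<open>z = \<Delta>(r) (s \<otimes> 1)\<close> can be computed by
  the left invariance of \<open>\<phi>\<close>.
\<close>

lemma D1_slice_r2:
  defines "K a \<equiv> tensor_lift sAA tAA sAA (\<lambda>q b. D1 (slice_r2 a b) q)"
  shows "K a (tAA q b) = D1 (slice_r2 a b) q" "Vector_Spaces.linear sAA sAA (K a)"
    "K a (D3 r s) = tAA (slice_r2 a r) s"
proof -
  have bil: "bilinear_map sA sA sAA (\<lambda>q b. D1 (slice_r2 a b) q)" for a
    by (rule XA.bilinear_mapI)
      (auto simp: D_bilinear slice_r2_add linearD[OF linear_slice_r2(2)] intro: XA.vT.vector_space_axioms)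
  show K_tens: "K a (tAA q b) = D1 (slice_r2 a b) q" for a q b
    unfolding K_def by (rule XA.tensor_lift_tens[OF bil])
  show lin: "Vector_Spaces.linear sAA sAA (K a)" for a
    unfolding K_def by (rule XA.linear_tensor_lift[OF bil])
  have linh: "Vector_Spaces.linear sA sA (\<lambda>v. sr \<phi> (app_l (\<Delta> v) z))" for z
    using vector_space_axioms XA.linear_sr[OF \<phi>]
    by (simp add: Vector_Spaces.linear_iff linearD[OF lin_\<Delta>])
  have mr_map: "app_r (mr q) (XA.map_right (\<lambda>v. slice_r2 v b) w) = XA.map_right (\<lambda>v. sr \<phi> (app_l (\<Delta> v) (tAA q b))) w"
    for q b w
    by (induction w rule: XA.tensor_induct)
      (simp_all add: XA.map_right_tens[OF linear_slice_r2(1)] XA.map_right_add[OF linear_slice_r2(1)] app_r_add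
        XA.map_right_tens[OF linh] XA.map_right_add[OF linh] slice_r2_mult)
  have ml_K: "app_l (ml p) (K a z) = XA.map_right (\<lambda>v. sr \<phi> (app_l (\<Delta> v) z)) (D2 p a)" for p a z
    by (induction z rule: XA.tensor_induct)
      (simp_all add: K_tens ml_D1 D2_slice_r2 mr_map app_l_add linearD(1)[OF lin] XA.sr_add[OF \<phi>]
        XA.map_right_fun_add[OF linh linh])
  have linq: "Vector_Spaces.linear sA sA (\<lambda>v. sA (\<phi> (v * r)) s)" for r s
    using linh[of "D3 r s"] by (simp add: \<Delta>_D3 \<phi>_invariant)
  have map_D3: "XA.map_right (\<lambda>v. sr \<phi> (app_l (\<Delta> v) (D3 r s))) w = tAA (sr \<phi> (app_r (mr r) w)) s" for r s w
    by (induction w rule: XA.tensor_induct)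
      (simp_all add: XA.map_right_tens[OF linq] XA.map_right_add[OF linq] \<Delta>_D3 \<phi>_invariant \<phi> app_r_add
        XA.sr_add[OF \<phi>] XA.tens_bilinear)
  have "app_l (ml p) (K a (D3 r s)) = app_l (ml p) (tAA (slice_r2 a r) s)" for p a r s
    by (simp add: ml_K map_D3 ml_D1[symmetric] XA.sr_app_ml[OF \<phi>] slice_r2_def)
  then show "K a (D3 r s) = tAA (slice_r2 a r) s" for a r s by (rule XA.cancel_ml)
qed

text \<open>
  With \<open>\<theta> = \<phi>(a \<cdot>)\<close> the functional is \<open>b \<mapsto> \<phi>(b\<^sub>1) \<theta>(b\<^sub>2)\<close>, and coassociativity and left invariance of
  \<open>\<phi>\<close> give \<open>b\<^sub>1 \<phi>(b\<^sub>2) \<theta>(b\<^sub>3) = \<phi>(b\<^sub>1) \<theta>(b\<^sub>2) 1\<close>.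
\<close>

lemma slice_l2_invariant: "sr (\<lambda>b. \<phi> (slice_l2 a b)) (D3 r s) = sA (\<phi> (slice_l2 a r)) s"
proof -
  have g: "Vector_Spaces.linear sA (*) (\<lambda>b. \<phi> (slice_l2 a b))"
    by (rule linear_compose_apply[OF linear_slice_l2 \<phi>])
  have *: "sr \<phi> (XA.map_right (slice_l2 a) w) = sr (\<lambda>b. \<phi> (slice_l2 a b)) w" for w
    by (induction w rule: XA.tensor_induct)
      (simp_all add: XA.map_right_tens[OF linear_slice_l2] XA.map_right_add[OF linear_slice_l2] \<phi> g XA.sr_add[OF \<phi>]
        XA.sr_add[OF g])
  have "sr (\<lambda>b. \<phi> (slice_l2 a b)) (D2 p c) = sA (\<phi> (slice_l2 a c)) p" for p c
    using \<phi>_invariant_D2[of p "slice_l2 a c"] by (simp add: D2_slice_l2 *)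
  then show ?thesis using invariance_D2_iff_D3[OF g] by blast
qed

text \<open>
  The functional is \<open>\<psi> = \<phi> \<circ> S\<close>. It is non-zero because \<open>\<psi>(a\<^sub>1 \<phi>(a\<^sub>2 b)) = (\<phi> \<otimes> \<phi>)((1 \<otimes> a) \<Delta>(b))\<close>
  and the \<open>(1 \<otimes> a) \<Delta>(b)\<close> span \<open>A \<otimes> A\<close>. For invariance at \<open>c = a\<^sub>1 \<phi>(a\<^sub>2 b)\<close>, both
  \<open>(\<psi> \<otimes> \<iota>)(\<Delta>(c) (1 \<otimes> q))\<close> and \<open>\<psi>(c) q\<close> are linear in \<open>q \<otimes> b\<close>. At \<open>\<Delta>(r) (s \<otimes> 1)\<close> in place of
  \<open>q \<otimes> b\<close>, the first is \<open>\<psi>(a\<^sub>1 \<phi>(a\<^sub>2 r)) s\<close> by \<open>D1_slice_r2\<close> and the second is \<open>\<phi>(r\<^sub>1 \<phi>(a r\<^sub>2)) s\<close>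
  by \<open>slice_l2_invariant\<close>; these are equal, and the \<open>\<Delta>(r) (s \<otimes> 1)\<close> span \<open>A \<otimes> A\<close>.
\<close>

lemma right_invariant_functional:
  obtains \<psi> where "Vector_Spaces.linear sA (*) \<psi>" "\<exists>a. \<psi> a \<noteq> 0" "\<And>a b. sl \<psi> (D1 a b) = sA (\<psi> a) b"
proof -
  obtain S where S: "Vector_Spaces.linear sA sA S" "\<And>a b. S (slice_r2 a b) = slice_l2 a b"
    using antipode by blast
  define \<psi> where "\<psi> a = \<phi> (S a)" for a
  have \<psi>: "Vector_Spaces.linear sA (*) \<psi>"
    unfolding \<psi>_def by (rule linear_compose_apply[OF S(1) \<phi>])
  have \<psi>_F: "\<psi> (slice_r2 a b) = \<phi> (slice_l2 a b)" for a b by (simp add: \<psi>_def S(2))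
  have "\<exists>a. \<psi> a \<noteq> 0"
  proof (rule ccontr)
    assume "\<not> (\<exists>a. \<psi> a \<noteq> 0)"
    then have "\<phi> (slice_l2 a b) = 0" for a b using \<psi>_F by metis
    then have "\<phi> (sr \<phi> (T4 t)) = 0" for t
      by (induction t rule: XA.tensor_induct)
        (simp_all add: slice_l2_def T_add XA.sr_add[OF \<phi>] linearD[OF \<phi>])
    then have 0: "\<phi> (sr \<phi> z) = 0" for z by (induction z rule: T4_induct)
    obtain a where "\<phi> a \<noteq> 0" using \<phi>_nonzero by blast
    then show False using 0[of "tAA a a"] by (simp add: \<phi> linearD[OF \<phi>])
  qed
  moreover have "sl \<psi> (D1 c q) = sA (\<psi> c) q" for c q
  proof (induction c rule: slice_r2_induct)
    case (slice a b)
    have g: "Vector_Spaces.linear sA (*) (\<lambda>b. \<phi> (slice_l2 a b))"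
      by (rule linear_compose_apply[OF linear_slice_l2 \<phi>])
    let ?K = "tensor_lift sAA tAA sAA (\<lambda>q b. D1 (slice_r2 a b) q)"
    note K = D1_slice_r2[of a]
    have "sl \<psi> (?K (T3 t)) = sr (\<lambda>b. \<phi> (slice_l2 a b)) (T3 t)" for t
      by (induction t rule: XA.tensor_induct)
        (simp_all add: K(3) \<psi> \<psi>_F slice_l2_invariant T_add linearD(1)[OF K(2)] XA.sl_add[OF \<psi>] XA.sr_add[OF g])
    then have "sl \<psi> (?K z) = sr (\<lambda>b. \<phi> (slice_l2 a b)) z" for z
      by (induction z rule: T3_induct)
    from this[of "tAA q b"] show ?case by (simp add: K(1) g \<psi>_F)
  next
    case (add c d)
    then show ?case by (simp add: D_bilinear XA.sl_add[OF \<psi>] linearD[OF \<psi>] scale_left_distrib)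
  qed
  ultimately show ?thesis using that \<psi> by blast
qed

end

end

section \<open>Galois objects\<close>

context galois_object
begin

sublocale nondegenerate_triple_tensor sX sA sA sXA tXA sAA tAA sXAA tL tR
  by unfold_locales

abbreviation "V \<equiv> cover_l1 tXA \<alpha>"

lemma linear_\<alpha>: "Vector_Spaces.linear sX (mscale sXA) \<alpha>"
  using hom by (simp add: algebra_hom_def)

lemmas galois_map = XX.bijective_onto_tensorD[OF XA.T.k_algebra_axioms XA.bilinear_multiplier_products(2)[OF linear_\<alpha>] galois_bij,
  folded cover_l1_def]

lemma galois_induct [case_names galois add]:
  assumes V: "\<And>y x. P (V y x)" and add: "\<And>s t. P s \<Longrightarrow> P t \<Longrightarrow> P (s + t)"
  shows "P z"
proof -
  let ?V = "tensor_lift sXX tXX sXA V"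
  have "P (?V t)" for t
    by (induction t rule: XX.tensor_induct)
      (simp_all add: XX.tensor_lift_tens[OF galois_map(2)] V add
        linearD(1)[OF XX.linear_tensor_lift[OF galois_map(2)]])
  moreover obtain t where "z = ?V t" using bij_is_surj[OF galois_map(3)] by (metis surjD)
  ultimately show ?thesis by simp
qed

text \<open>
  A functional \<open>g\<close> that kills all products satisfies \<open>(g \<otimes> \<iota>)((y \<otimes> 1) \<alpha>(z) (1 \<otimes> c)) = 0\<close>, because
  \<open>\<alpha>(z) (1 \<otimes> c)\<close> lies in \<open>X \<otimes> A\<close>. Cancelling \<open>c\<close> shows that \<open>g \<otimes> \<iota>\<close> is zero on the image of the
  Galois map, which is all of \<open>X \<otimes> A\<close>.
\<close>

lemma idempotent_X: "idempotent_algebra sX"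
proof (rule X.idempotent_algebraI)
  fix g x assume g: "Vector_Spaces.linear sX (*) g" and 0: "\<And>y z. g (y * z) = 0"
  have 1: "XA.sl g (app_l (XA.ml y) w) = 0" for y w
    by (induction w rule: XA.tensor_induct) (simp_all add: g 0 app_l_add XA.sl_add[OF g])
  have "app_r (XA.mr c) (V y z) = app_l (XA.ml y) (cover_r2 tXA \<alpha> z c)" for c y z
    by (simp flip: XA.T.emb_eq_iff mult_emb emb_mult_left
        add: cover_l1_def cover_r2_def emb_inv_emb reduced covers_r mult.assoc)
  then have "XA.sl g (V y z) * c = 0" for y z c
    by (metis 1 XA.sl_app_mr(2)[OF g])
  then have "XA.sl g (V y z) = 0" for y z by (rule A.nondegenerate_left)
  then have 2: "XA.sl g w = 0" for w
    by (induction w rule: galois_induct) (simp_all add: XA.sl_add[OF g])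
  obtain a :: 'a where "a \<noteq> 0" using A.nonzero by blast
  then show "g x = 0" using 2[of "tXA x a"] by (simp add: g)
qed

end

theorem proposition2p4:
  fixes sA :: "'k::field \<Rightarrow> 'a::ring \<Rightarrow> 'a"
    and sAA :: "'k \<Rightarrow> 'aa::ring \<Rightarrow> 'aa" and tAA :: "'a \<Rightarrow> 'a \<Rightarrow> 'aa"
    and sAAA :: "'k \<Rightarrow> 'aaa::ring \<Rightarrow> 'aaa"
    and tAA_A :: "'aa \<Rightarrow> 'a \<Rightarrow> 'aaa" and tA_AA :: "'a \<Rightarrow> 'aa \<Rightarrow> 'aaa"
    and \<Delta> :: "'a \<Rightarrow> 'aa multiplier"
    and sX :: "'k \<Rightarrow> 'x::ring \<Rightarrow> 'x"
    and sXA :: "'k \<Rightarrow> 'xa::ring \<Rightarrow> 'xa" and tXA :: "'x \<Rightarrow> 'a \<Rightarrow> 'xa"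
    and sXAA :: "'k \<Rightarrow> 'xaa::ring \<Rightarrow> 'xaa"
    and tXA_A :: "'xa \<Rightarrow> 'a \<Rightarrow> 'xaa" and tX_AA :: "'x \<Rightarrow> 'aa \<Rightarrow> 'xaa"
    and sXX :: "'k \<Rightarrow> 'xx::ab_group_add \<Rightarrow> 'xx" and tXX :: "'x \<Rightarrow> 'x \<Rightarrow> 'xx"
    and \<alpha> :: "'x \<Rightarrow> 'xa multiplier"
  assumes A: "algebraic_quantum_group sA sAA tAA sAAA tAA_A tA_AA \<Delta>"
    and X: "galois_object sA sAA tAA \<Delta> sX sXA tXA sXAA tXA_A tX_AA \<alpha> sXX tXX"
  shows "\<exists>\<psi> :: 'x \<Rightarrow> 'k. Vector_Spaces.linear sX (*) \<psi> \<and> (\<exists>x. \<psi> x \<noteq> 0) \<and>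
           (\<forall>x. mult_slice_left sA sXA tXA \<psi> (\<alpha> x) = scalar sA (\<psi> x))"
proof -
  interpret H: algebraic_quantum_group sA sAA tAA sAAA tAA_A tA_AA \<Delta> by fact
  interpret G: galois_object sA sAA tAA \<Delta> sX sXA tXA sXAA tXA_A tX_AA \<alpha> sXX tXX by fact
  interpret C: reduced_coaction sX sA sXA tXA sAA tAA sXAA tXA_A tX_AA \<Delta> \<alpha>
    by unfold_locales
      (use G.hom G.covers_r G.covers_l G.reduced G.coassoc G.idempotent_X H.hom_\<Delta> H.covers_\<Delta>_r
        H.covers_\<Delta>_l H.span_\<Delta>_l H.span_\<Delta>_r H.idempotent_A in auto)
  obtain \<phi> where \<phi>: "Vector_Spaces.linear sA (*) \<phi>" "\<exists>a. \<phi> a \<noteq> 0"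
    "\<And>a b. H.sr \<phi> (H.D3 a b) = sA (\<phi> a) b"
    using H.left_invariant_functional unfolding cover_r1_def by blast
  obtain \<psi> where \<psi>: "Vector_Spaces.linear sA (*) \<psi>" "\<exists>a. \<psi> a \<noteq> 0"
    and \<psi>_inv: "\<And>a b. H.sl \<psi> (H.D1 a b) = sA (\<psi> a) b"
    using H.right_invariant_functional[OF \<phi>] by blast
  obtain a where a: "\<psi> a \<noteq> 0" using \<psi>(2) by blast
  obtain x0 :: 'x where x0: "x0 \<noteq> 0" using G.X.nonzero by blast
  obtain \<omega> where \<omega>: "Vector_Spaces.linear sX (*) \<omega>" "\<omega> x0 = 1"
    using G.X.separating_functional[of x0 "{}"] x0 by auto
  have "\<exists>y x. \<psi> (G.XA.sl \<omega> (G.V y x)) \<noteq> 0"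
  proof (rule ccontr)
    assume "\<not> (\<exists>y x. \<psi> (G.XA.sl \<omega> (G.V y x)) \<noteq> 0)"
    then have "\<psi> (G.XA.sl \<omega> z) = 0" for z
      by (induction z rule: G.galois_induct) (auto simp: G.XA.sl_add[OF \<omega>(1)] linearD[OF \<psi>(1)])
    from this[of "tXA x0 a"] show False using a by (simp add: \<omega> linearD[OF \<psi>(1)])
  qed
  then obtain y x1 where nonzero: "\<psi> (G.XA.sl \<omega> (G.V y x1)) \<noteq> 0" by blast
  define \<chi> where "\<chi> x = \<psi> (G.XA.sl \<omega> (G.V y x))" for x
  have \<chi>: "Vector_Spaces.linear sX (*) \<chi>"
    and r2: "G.XA.sl \<chi> (cover_r2 tXA \<alpha> x a) = sA (\<chi> x) a" for x a
    using C.invariant_on_X[OF \<psi>(1) \<omega>(1) \<psi>_inv, of y] unfolding \<chi>_def[abs_def] by auto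
  \<comment> \<open>\<open>(\<chi> \<otimes> \<iota>)((1 \<otimes> a) \<alpha>(x) (1 \<otimes> b))\<close> is computed in two ways, and \<open>b\<close> is cancelled.\<close>
  have l2: "G.XA.sl \<chi> (cover_l2 tXA \<alpha> a x) = sA (\<chi> x) a" for a x
  proof -
    have "(G.XA.sl \<chi> (cover_l2 tXA \<alpha> a x) - sA (\<chi> x) a) * b = 0" for b
      using arg_cong[OF C.mr_cover_r2[of a x b], of "G.XA.sl \<chi>"]
      by (simp add: G.XA.sl_app_mr[OF \<chi>] r2 left_diff_distrib
        flip: H.scale_mult_left H.scale_mult_right)
    then show ?thesis using H.nondegenerate_left[of "G.XA.sl \<chi> (cover_l2 tXA \<alpha> a x) - sA (\<chi> x) a"] by simp
  qed
  have "mult_slice_left sA sXA tXA \<chi> (\<alpha> x) = scalar sA (\<chi> x)" for x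
    unfolding mult_slice_left_def cover_r2_def[symmetric] cover_l2_def[symmetric]
    by (rule the_equality) (auto simp: r2 l2 intro!: multiplier_eqI)
  then show ?thesis using \<chi> nonzero unfolding \<chi>_def[symmetric] by blast
qed

end
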